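(* Let $(X,\|\cdot\|_X)$ be a two-dimensional real normed space such that $S_X$ is piecewise $C^1$-differentiable and such that there exist two linearly independent points $x,\overline{x}\in S_X$ at which $\|\cdot\|_X$ is not differentiable. Then for every two-dimensional real normed space $(Y,\|\cdot\|_Y)$, every surjective isometry $\tau:S_X\to S_Y$ (i.e. $\|\tau(u)-\tau(v)\|_Y=\|u-v\|_X$ for all $u,v\in S_X$) is linear, i.e. it is the restriction to $S_X$ of a linear map $X\to Y$ (which is then a linear isometry).
   Context: $S_X=\{x\in X:\|x\|_X=1\}$ denotes the unit sphere. $S_X$ is called piecewise $C^1$-differentiable if the norm $\|\cdot\|_X$ fails to be differentiable at only finitely many points of $S_X$. *)

theory Defs
  imports "HOL-Analysis.Analysis"
begin

definition unit_sphere :: "'a::real_normed_vector set" where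
  "unit_sphere = {x. norm x = 1}"

definition nondiff_points :: "'a::real_normed_vector set" where
  "nondiff_points = {x \<in> unit_sphere. \<not> ((\<lambda>z::'a. norm z) differentiable (at x))}"

definition piecewise_C1_sphere :: "'a::real_normed_vector itself \<Rightarrow> bool" where
  "piecewise_C1_sphere _ \<longleftrightarrow> finite (nondiff_points :: 'a set)"

end

theory Submission
  imports Defs
begin

text \<open>
  Let \<open>x\<close> be a singular unit vector, and slice the unit sphere of \<open>X\<close> by the lines parallel to \<open>x\<close>.
  As one end of such a chord moves along the sphere, its length has a corner, since the norm has one
  at \<open>x\<close>. The isometry preserves this corner, and it forces the direction of the image chord to be a
  singular point of the sphere of \<open>Y\<close>, for all but countably many chords. There are only countably
  many singular points and the direction varies continuously, so all image chords are parallel to one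
  singular vector \<open>y\<close>.

  The left and right derivatives of the norm at \<open>x\<close> are two independent functionals, and they give the
  one-sided first-order change of chord lengths. Comparing with the same functionals at \<open>y\<close> shows that
  \<open>\<tau>\<close> agrees with an affine map \<open>T + c\<close> on the sphere. Antipodal points then show that \<open>T\<close> is
  isometric, and \<open>c = 0\<close> because a nonzero \<open>c\<close> would push the point in its own direction off the
  sphere.
\<close>

section \<open>Convex functions on a real interval\<close>

text \<open>Keep the lower end of a chord fixed and move the upper end by a parameter step
  \<open>h > 0\<close> to either side. In \<open>X\<close> the second difference of the length,
  divided by \<open>h\<close>, is asymptotically at least \<open>cp - cm > 0\<close>. In
  \<open>Y\<close>, if the norm were differentiable at the direction of the image chord, the same
  quotient would depend only on the sum of the two displacements of the image end, and that sum is
  \<open>o(h)\<close> at a smooth point of the sphere. The obstacle is that the image curve is not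
  known to have a tangent, so this cancellation is extracted from distances alone: from each
  displaced end to the base point, and between the two displaced ends. The exceptional parameters,
  where the arc or the sphere at the image point has a corner, are countable because a convex
  function of one variable has countably many corners. A one-sided derivative describes the chord
  length only while the end moves to one side. The image end must therefore move to a definite side
  too; this order comes from injectivity and continuity of one coordinate, and a reversed order is
  absorbed by reflecting the frame in \<open>Y\<close>.\<close>

lemma convex_on_right_slope:
  fixes f :: "real \<Rightarrow> real"
  assumes f: "convex_on {a<..<b} f" and t: "t \<in> {a<..<b}"
  obtains q where "\<And>s. s \<in> {t<..<b} \<Longrightarrow> q * (s - t) \<le> f s - f t"
    and "\<And>\<epsilon>. \<epsilon> > 0 \<Longrightarrow> \<exists>\<delta>>0. \<forall>s. t < s \<and> s < t + \<delta> \<longrightarrow> f s - f t \<le> (q + \<epsilon>) * (s - t)"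
proof -
  define Q where "Q s = (f s - f t) / (s - t)" for s
  have flip: "(f u - f v) / (u - v) = (f v - f u) / (v - u)" for u v
    by (metis minus_diff_eq minus_divide_divide)
  have mono: "Q s \<le> Q s'" if "t < s" "s < s'" "s' < b" for s s'
    using convex_on_slope_le(1)[OF f, of t s' s] that t flip[of t s] flip[of t s']
    by (simp add: Q_def)
  obtain s0 where s0: "a < s0" "s0 < t" using t dense by auto
  have low: "Q s0 \<le> Q s" if "s \<in> {t<..<b}" for s
  proof -
    have "(f s0 - f t) / (s0 - t) \<le> (f t - f s) / (t - s)"
      using convex_on_slope_le[OF f, of s0 s t] that t s0 by force
    then show ?thesis using flip[of t s] by (simp add: Q_def)
  qed
  have bdd: "bdd_below (Q ` {t<..<b})"
    using low by (meson bdd_belowI2)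
  have ne: "Q ` {t<..<b} \<noteq> {}" using t by auto
  \<comment> \<open>Slopes to the right of \<open>t\<close> decrease as \<open>s\<close> approaches
    \<open>t\<close> and stay above any slope from the left, so this infimum is the right
    derivative.\<close>
  define q where "q = Inf (Q ` {t<..<b})"
  have qQ: "q \<le> Q s" if "s \<in> {t<..<b}" for s
    unfolding q_def using bdd that by (meson cINF_lower)
  show thesis
  proof
    show "q * (s - t) \<le> f s - f t" if "s \<in> {t<..<b}" for s
      using qQ[OF that] that by (simp add: Q_def field_simps)
  next
    fix \<epsilon> :: real assume "\<epsilon> > 0"
    then have "Inf (Q ` {t<..<b}) < q + \<epsilon>" by (simp add: q_def)
    then obtain s1 where s1: "s1 \<in> {t<..<b}" "Q s1 < q + \<epsilon>"
      using cInf_lessD[OF ne] by blast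
    show "\<exists>\<delta>>0. \<forall>s. t < s \<and> s < t + \<delta> \<longrightarrow> f s - f t \<le> (q + \<epsilon>) * (s - t)"
    proof (intro exI[of _ "s1 - t"] conjI allI impI)
      fix s assume "t < s \<and> s < t + (s1 - t)"
      then have "Q s \<le> q + \<epsilon>" "t < s"
        using mono[of s s1] s1 by auto
      then show "f s - f t \<le> (q + \<epsilon>) * (s - t)"
        by (simp add: Q_def field_simps)
    qed (use s1 in auto)
  qed
qed

text \<open>The left slope comes from applying the right-hand case to the reflected function. Both
  slopes are recorded as subgradients on the whole interval; these lower bounds later become
  functionals supporting the norm.\<close>

lemma convex_on_one_sided_slopes:
  fixes f :: "real \<Rightarrow> real"
  assumes f: "convex_on {a<..<b} f" and t: "t \<in> {a<..<b}"
  obtains p q where "p \<le> q"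
    and "\<And>s. s \<in> {a<..<b} \<Longrightarrow> p * (s - t) \<le> f s - f t"
    and "\<And>s. s \<in> {a<..<b} \<Longrightarrow> q * (s - t) \<le> f s - f t"
    and "\<And>\<epsilon>. \<epsilon> > 0 \<Longrightarrow> \<exists>\<delta>>0. \<forall>s. t < s \<and> s < t + \<delta> \<longrightarrow> f s - f t \<le> (q + \<epsilon>) * (s - t)"
    and "\<And>\<epsilon>. \<epsilon> > 0 \<Longrightarrow> \<exists>\<delta>>0. \<forall>s. t - \<delta> < s \<and> s < t \<longrightarrow> f s - f t \<le> (p - \<epsilon>) * (s - t)"
proof -
  obtain q where q: "\<And>s. s \<in> {t<..<b} \<Longrightarrow> q * (s - t) \<le> f s - f t"
      "\<And>\<epsilon>. \<epsilon> > 0 \<Longrightarrow> \<exists>\<delta>>0. \<forall>s. t < s \<and> s < t + \<delta> \<longrightarrow> f s - f t \<le> (q + \<epsilon>) * (s - t)"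
    using convex_on_right_slope[OF assms] by blast
  have f': "convex_on {-b<..<-a} (\<lambda>s. f (- s))"
  proof (intro convex_onI)
    fix u x y :: real
    assume "0 < u" "u < 1" "x \<in> {-b<..<-a}" "y \<in> {-b<..<-a}"
    then show "f (- ((1 - u) *\<^sub>R x + u *\<^sub>R y)) \<le> (1 - u) * f (- x) + u * f (- y)"
      using convex_onD[OF f, of u "-x" "-y"] by (simp add: algebra_simps)
  qed simp
  obtain p' where p': "\<And>s. s \<in> {-t<..<-a} \<Longrightarrow> p' * (s - - t) \<le> f (- s) - f t"
      "\<And>\<epsilon>. \<epsilon> > 0 \<Longrightarrow> \<exists>\<delta>>0. \<forall>s. -t < s \<and> s < -t + \<delta> \<longrightarrow> f (- s) - f t \<le> (p' + \<epsilon>) * (s - - t)"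
    using convex_on_right_slope[OF f', of "-t"] t by auto
  define p where "p = - p'"
  have p1: "p * (s - t) \<le> f s - f t" if "s \<in> {a<..<t}" for s
    using p'(1)[of "-s"] that by (simp add: p_def algebra_simps)
  have p2: "\<exists>\<delta>>0. \<forall>s. t - \<delta> < s \<and> s < t \<longrightarrow> f s - f t \<le> (p - \<epsilon>) * (s - t)" if e: "\<epsilon> > 0" for \<epsilon>
  proof -
    obtain \<delta> where \<delta>: "\<delta> > 0" "\<And>s. -t < s \<and> s < -t + \<delta> \<Longrightarrow> f (- s) - f t \<le> (p' + \<epsilon>) * (s - - t)"
      using p'(2)[OF e] by blast
    show ?thesis
    proof (intro exI[of _ \<delta>] conjI allI impI)
      fix s assume "t - \<delta> < s \<and> s < t"
      then show "f s - f t \<le> (p - \<epsilon>) * (s - t)"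
        using \<delta>(2)[of "-s"] by (simp add: p_def algebra_simps)
    qed (use \<delta> in auto)
  qed
  \<comment> \<open>Midpoint convexity is what forces \<open>p \<le> q\<close>: the two one-sided
    upper estimates add up to \<open>(q + e - p) * h\<close>, which therefore cannot be
    negative.\<close>
  have cvx: "f t \<le> (f (t - h) + f (t + h)) / 2" if "a < t - h" "t + h < b" "h > 0" for h
    using convex_onD[OF f, of "1/2" "t-h" "t+h"] that by (simp add: field_simps)
  have le: "p \<le> q"
  proof (rule field_le_epsilon)
    fix e :: real assume "e > 0"
    obtain \<delta>1 where \<delta>1: "\<delta>1 > 0" "\<And>s. t < s \<and> s < t + \<delta>1 \<Longrightarrow> f s - f t \<le> (q + e/2) * (s - t)"
      using q(2)[of "e/2"] \<open>e > 0\<close> by auto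
    obtain \<delta>2 where \<delta>2: "\<delta>2 > 0" "\<And>s. t - \<delta>2 < s \<and> s < t \<Longrightarrow> f s - f t \<le> (p - e/2) * (s - t)"
      using p2[of "e/2"] \<open>e > 0\<close> by auto
    have "0 < Min {\<delta>1, \<delta>2, b - t, t - a}" using \<delta>1(1) \<delta>2(1) t by auto
    then obtain h where "0 < h" "h < Min {\<delta>1, \<delta>2, b - t, t - a}" using dense by blast
    then have h: "0 < h" "h < \<delta>1" "h < \<delta>2" "t + h < b" "a < t - h"
      by auto
    have "f (t + h) - f t \<le> (q + e/2) * h" "f (t - h) - f t \<le> (p - e/2) * (- h)"
      using \<delta>1(2)[of "t+h"] \<delta>2(2)[of "t-h"] h by auto
    then have "0 \<le> (q + e - p) * h"
      using cvx[of h] h by (simp add: algebra_simps)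
    then show "p \<le> q + e"
      using h by (simp add: zero_le_mult_iff)
  qed
  show thesis
  proof (rule that[OF le _ _ q(2) p2])
    fix s assume s: "s \<in> {a<..<b}"
    consider "s < t" | "s = t" | "t < s" by linarith
    then show "p * (s - t) \<le> f s - f t"
    proof cases
      case 3
      then show ?thesis
        using order_trans[OF mult_right_mono[OF le, of "s - t"] q(1)[of s]] s by simp
    qed (use p1[of s] s in auto)
    consider "s < t" | "s = t" | "t < s" by linarith
    then show "q * (s - t) \<le> f s - f t"
    proof cases
      case 1
      then show ?thesis
        using order_trans[OF mult_right_mono_neg[OF le, of "s - t"] p1[of s]] s by simp
    qed (use q(1)[of s] s in auto)
  qed auto
qed

text \<open>At a corner the left slope lies strictly below the right slope, so a rational fits
  between them. These gaps are ordered like the points, hence the choice of rational is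
  injective.\<close>

lemma countable_nondifferentiable_convex:
  fixes f :: "real \<Rightarrow> real"
  assumes f: "convex_on {a<..<b} f"
  shows "countable {t \<in> {a<..<b}. \<not> f differentiable (at t)}" (is "countable ?N")
proof -
  define P where "P t c \<longleftrightarrow> c \<in> \<rat> \<and> (\<exists>p q. p < c \<and> c < q \<and>
      (\<forall>s\<in>{a<..<b}. p * (s - t) \<le> f s - f t) \<and> (\<forall>s\<in>{a<..<b}. q * (s - t) \<le> f s - f t))" for t c
  have ex: "\<exists>c. P t c" if tN: "t \<in> ?N" for t
  proof -
    have t: "t \<in> {a<..<b}" using tN by simp
    obtain p q where pq: "p \<le> q"
      "\<And>s. s \<in> {a<..<b} \<Longrightarrow> p * (s - t) \<le> f s - f t"
      "\<And>s. s \<in> {a<..<b} \<Longrightarrow> q * (s - t) \<le> f s - f t"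
      "\<And>\<epsilon>. \<epsilon> > 0 \<Longrightarrow> \<exists>\<delta>>0. \<forall>s. t < s \<and> s < t + \<delta> \<longrightarrow> f s - f t \<le> (q + \<epsilon>) * (s - t)"
      "\<And>\<epsilon>. \<epsilon> > 0 \<Longrightarrow> \<exists>\<delta>>0. \<forall>s. t - \<delta> < s \<and> s < t \<longrightarrow> f s - f t \<le> (p - \<epsilon>) * (s - t)"
      using convex_on_one_sided_slopes[OF f t] by blast
    have "p \<noteq> q"
    proof
      assume "p = q"
      have "(f has_derivative (\<lambda>h. q * h)) (at t)"
        unfolding has_derivative_at_alt
      proof (intro conjI allI impI)
        show "bounded_linear (\<lambda>h. q * h)" by (rule bounded_linear_mult_right)
        fix e :: real assume "e > 0"
        obtain \<delta>1 where \<delta>1: "\<delta>1 > 0" "\<And>s. t < s \<and> s < t + \<delta>1 \<Longrightarrow> f s - f t \<le> (q + e) * (s - t)"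
          using pq(4)[OF \<open>e > 0\<close>] by auto
        obtain \<delta>2 where \<delta>2: "\<delta>2 > 0" "\<And>s. t - \<delta>2 < s \<and> s < t \<Longrightarrow> f s - f t \<le> (p - e) * (s - t)"
          using pq(5)[OF \<open>e > 0\<close>] by auto
        show "\<exists>d>0. \<forall>y. norm (y - t) < d \<longrightarrow> norm (f y - f t - q * (y - t)) \<le> e * norm (y - t)"
        proof (intro exI[of _ "Min {\<delta>1, \<delta>2, b - t, t - a}"] conjI allI impI)
          show "0 < Min {\<delta>1, \<delta>2, b - t, t - a}" using \<delta>1 \<delta>2 t by auto
          fix y assume "norm (y - t) < Min {\<delta>1, \<delta>2, b - t, t - a}"
          then have y: "y \<in> {a<..<b}" "y < t + \<delta>1" "t - \<delta>2 < y" by auto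
          have low: "q * (y - t) \<le> f y - f t" by (rule pq(3)[OF y(1)])
          consider "y < t" | "y = t" | "t < y" by linarith
          then show "norm (f y - f t - q * (y - t)) \<le> e * norm (y - t)"
          proof cases
            case 1
            then have "f y - f t \<le> (q - e) * (y - t)" using \<delta>2(2)[of y] y \<open>p = q\<close> by auto
            then show ?thesis using low 1 by (simp add: algebra_simps)
          next
            case 3
            then have "f y - f t \<le> (q + e) * (y - t)" using \<delta>1(2)[of y] y by auto
            then show ?thesis using low 3 by (simp add: algebra_simps)
          qed auto
        qed
      qed
      then show False using tN by (auto simp: differentiable_def)
    qed
    then obtain c where "c \<in> \<rat>" "p < c" "c < q" using pq(1) Rats_dense_in_real[of p q] by auto
    then show ?thesis unfolding P_def using pq(2,3) by blast
  qed
  then obtain c where c: "\<And>t. t \<in> ?N \<Longrightarrow> P t (c t)"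
    by metis
  \<comment> \<open>The secant slope between \<open>s\<close> and \<open>t\<close> lies above
    \<open>q\<close>, a subgradient at \<open>s\<close>, and below \<open>p\<close>, a subgradient
    at \<open>t\<close>; so \<open>c s < q \<le> p < c t\<close>.\<close>
  have lt: "c s < c t" if st: "s \<in> ?N" "t \<in> ?N" "s < t" for s t
  proof -
    obtain p where "p < c t" "p * (s - t) \<le> f s - f t" using c[OF st(2)] st unfolding P_def by blast
    moreover obtain q where "c s < q" "q * (t - s) \<le> f t - f s" using c[OF st(1)] st unfolding P_def by blast
    ultimately have "q * (t - s) \<le> p * (t - s)" by (simp add: algebra_simps)
    then have "q \<le> p" using st(3) by simp
    then show ?thesis using \<open>c s < q\<close> \<open>p < c t\<close> by linarith
  qed
  have "inj_on c ?N"
  proof (rule inj_onI)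
    fix s t assume "s \<in> ?N" "t \<in> ?N" "c s = c t"
    then show "s = t" using lt[of s t] lt[of t s] by (cases s t rule: linorder_cases) auto
  qed
  moreover have "countable (c ` ?N)"
    by (rule countable_subset[OF _ countable_rat]) (use c in \<open>auto simp: P_def\<close>)
  ultimately show ?thesis using countable_image_inj_on by blast
qed

text \<open>Continuity induction: the set where the \<open>\<epsilon>\<close>-bound from
  \<open>u\<close> persists is closed, and at its supremum the right derivative allows a further
  step. The one-sided form matches the chord estimates, which follow an end moving in one
  direction.\<close>

lemma zero_right_derivative_imp_constant:
  fixes f :: "real \<Rightarrow> real"
  assumes cont: "continuous_on {a<..<b} f"
    and der: "\<And>t \<epsilon>. t \<in> {a<..<b} \<Longrightarrow> \<epsilon> > 0 \<Longrightarrow>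
      \<exists>\<delta>>0. \<forall>s. t < s \<and> s < t + \<delta> \<longrightarrow> \<bar>f s - f t\<bar> \<le> \<epsilon> * (s - t)"
    and st: "s \<in> {a<..<b}" "t \<in> {a<..<b}"
  shows "f s = f t"
proof -
  have main: "\<bar>f v - f u\<bar> \<le> \<epsilon> * (v - u)" if uv: "a < u" "u \<le> v" "v < b" and "\<epsilon> > 0" for u v \<epsilon>
  proof -
    define S where "S = {w \<in> {u..v}. \<bar>f w - f u\<bar> \<le> \<epsilon> * (w - u)}"
    have cuv: "continuous_on {u..v} f" using cont by (rule continuous_on_subset) (use uv in auto)
    have "closed S"
      unfolding S_def
      by (intro continuous_on_closed_Collect_le continuous_intros cuv)
    have "u \<in> S" using uv by (simp add: S_def)
    have bdd: "bdd_above S" by (auto simp: S_def)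
    define w where "w = Sup S"
    have wS: "w \<in> S" unfolding w_def using \<open>closed S\<close> \<open>u \<in> S\<close> bdd
      by (intro closed_contains_Sup) auto
    have "w = v"
    proof (rule ccontr)
      assume "w \<noteq> v"
      then have w: "u \<le> w" "w < v" using wS by (auto simp: S_def)
      obtain \<delta> where \<delta>: "\<delta> > 0" "\<And>s. w < s \<and> s < w + \<delta> \<Longrightarrow> \<bar>f s - f w\<bar> \<le> \<epsilon> * (s - w)"
        using der[of w \<epsilon>] w uv \<open>\<epsilon> > 0\<close> by auto
      define z where "z = min (w + \<delta> / 2) v"
      have z: "w < z" "z < w + \<delta>" "z \<le> v" using \<delta> w by (auto simp: z_def)
      have "\<bar>f z - f u\<bar> \<le> \<epsilon> * (z - w) + \<epsilon> * (w - u)"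
        using \<delta>(2)[of z] z wS by (auto simp: S_def)
      then have "z \<in> S" using z w by (auto simp: S_def algebra_simps)
      then have "z \<le> w" unfolding w_def using bdd by (rule cSup_upper)
      then show False using z by simp
    qed
    then show ?thesis using wS by (simp add: S_def)
  qed
  have eq: "f v = f u" if uv: "a < u" "u \<le> v" "v < b" for u v
  proof -
    have "\<bar>f v - f u\<bar> \<le> 0"
    proof (rule field_le_epsilon)
      fix e :: real assume "e > 0"
      have "\<bar>f v - f u\<bar> \<le> e / (v - u + 1) * (v - u)"
        using main[OF uv, of "e / (v - u + 1)"] \<open>e > 0\<close> uv by simp
      also have "\<dots> \<le> e" using \<open>e > 0\<close> uv by (simp add: field_simps)
      finally show "\<bar>f v - f u\<bar> \<le> 0 + e" by simp
    qed
    then show ?thesis by simp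
  qed
  show ?thesis
    using eq[of s t] eq[of t s] st by (cases "s \<le> t") auto
qed

section \<open>Coordinates adapted to a point of the unit sphere\<close>

lemma convex_on_norm_line:
  fixes x e :: "'a::real_normed_vector"
  assumes "convex S"
  shows "convex_on S (\<lambda>t. norm (x + t *\<^sub>R e))"
proof (intro convex_onI)
  fix u s t :: real assume "0 < u" "u < 1"
  have "x + ((1 - u) *\<^sub>R s + u *\<^sub>R t) *\<^sub>R e = (1 - u) *\<^sub>R (x + s *\<^sub>R e) + u *\<^sub>R (x + t *\<^sub>R e)"
    by (simp add: algebra_simps)
  then show "norm (x + ((1 - u) *\<^sub>R s + u *\<^sub>R t) *\<^sub>R e)
      \<le> (1 - u) * norm (x + s *\<^sub>R e) + u * norm (x + t *\<^sub>R e)"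
    using \<open>0 < u\<close> \<open>u < 1\<close>
      norm_triangle_ineq[of "(1 - u) *\<^sub>R (x + s *\<^sub>R e)" "u *\<^sub>R (x + t *\<^sub>R e)"] by simp
qed (rule assms)

text \<open>The functional \<open>be\<close> has norm one, kernel spanned by \<open>x\<close>, and attains its norm at \<open>e\<close>;
  \<open>cm\<close> and \<open>cp\<close> are the left and right derivatives of \<open>t \<mapsto> norm (x + t e)\<close> at \<open>0\<close>.\<close>

locale sphere_frame =
  fixes x e :: "'a::real_normed_vector" and al be :: "'a \<Rightarrow> real" and cm cp :: real
  assumes lin_al: "linear al" and lin_be: "linear be"
    and decomp: "z = al z *\<^sub>R x + be z *\<^sub>R e"
    and al_x [simp]: "al x = 1" and be_x [simp]: "be x = 0"
    and al_e [simp]: "al e = 0" and be_e [simp]: "be e = 1"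
    and norm_x [simp]: "norm x = 1" and norm_e [simp]: "norm e = 1"
    and abs_be_le: "\<bar>be z\<bar> \<le> norm z"
    and cm_le_cp: "cm \<le> cp"
    and right_functional_le: "al z + cp * be z \<le> norm z"
    and left_functional_le: "al z + cm * be z \<le> norm z"
    and norm_le_right: "\<epsilon> > 0 \<Longrightarrow>
      \<exists>\<delta>>0. \<forall>z. 0 \<le> be z \<and> be z \<le> \<delta> * al z \<longrightarrow> norm z \<le> al z + cp * be z + \<epsilon> * be z"
    and norm_le_left: "\<epsilon> > 0 \<Longrightarrow>
      \<exists>\<delta>>0. \<forall>z. be z \<le> 0 \<and> - be z \<le> \<delta> * al z \<longrightarrow> norm z \<le> al z + cm * be z - \<epsilon> * be z"
begin

lemma al_simps [simp]:
  "al (u + v) = al u + al v" "al (u - v) = al u - al v" "al (c *\<^sub>R u) = c * al u" "al (- u) = - al u" "al 0 = 0"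
  using lin_al by (simp_all add: linear_add linear_diff linear_scale linear_neg linear_0)

lemma be_simps [simp]:
  "be (u + v) = be u + be v" "be (u - v) = be u - be v" "be (c *\<^sub>R u) = c * be u" "be (- u) = - be u" "be 0 = 0"
  using lin_be by (simp_all add: linear_add linear_diff linear_scale linear_neg linear_0)

lemma eqI: "al u = al v \<Longrightarrow> be u = be v \<Longrightarrow> u = v"
  using decomp[of u] decomp[of v] by simp

lemma abs_al_le: "\<bar>al z\<bar> \<le> 2 * norm z"
proof -
  have "\<bar>al z\<bar> = norm (z - be z *\<^sub>R e)"
    using decomp[of z] by (metis add_diff_cancel_right' mult.right_neutral norm_scaleR norm_x)
  also have "\<dots> \<le> norm z + norm (be z *\<^sub>R e)" by (rule norm_triangle_ineq4)
  finally show ?thesis using abs_be_le[of z] by simp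
qed

lemma bounded_linear_al: "bounded_linear al"
  using abs_al_le by (intro bounded_linear_intro[where K = 2]) (auto simp: mult.commute)

lemma bounded_linear_be: "bounded_linear be"
  using abs_be_le by (intro bounded_linear_intro[where K = 1]) (auto simp: mult.commute)

text \<open>Reversing \<open>e\<close> exchanges the two one-sided derivatives, so statements about
  the left slope follow from those about the right slope.\<close>

lemma reflect: "sphere_frame x (- e) al (\<lambda>z. - be z) (- cp) (- cm)"
  unfolding sphere_frame_def
proof (intro conjI allI impI)
  show "linear al" by (rule lin_al)
  show "linear (\<lambda>z. - be z)" using lin_be by (rule linear_compose_neg)
  fix z
  show "z = al z *\<^sub>R x + - be z *\<^sub>R - e" using decomp[of z] by simp
  show "\<bar>- be z\<bar> \<le> norm z" using abs_be_le[of z] by simp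
  show "al z + - cm * - be z \<le> norm z" using left_functional_le[of z] by simp
  show "al z + - cp * - be z \<le> norm z" using right_functional_le[of z] by simp
next
  fix \<epsilon> :: real assume "\<epsilon> > 0"
  show "\<exists>\<delta>>0. \<forall>z. 0 \<le> - be z \<and> - be z \<le> \<delta> * al z \<longrightarrow> norm z \<le> al z + - cm * - be z + \<epsilon> * - be z"
    using norm_le_left[OF \<open>\<epsilon> > 0\<close>] by auto
  show "\<exists>\<delta>>0. \<forall>z. - be z \<le> 0 \<and> - (- be z) \<le> \<delta> * al z \<longrightarrow> norm z \<le> al z + - cp * - be z - \<epsilon> * - be z"
    using norm_le_right[OF \<open>\<epsilon> > 0\<close>] by auto
qed (use cm_le_cp in auto)

lemma norm_differentiable_if_slopes_eq:
  assumes "cm = cp"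
  shows "norm differentiable (at x)"
proof -
  have "(norm has_derivative (\<lambda>z. al z + cp * be z)) (at x)"
    unfolding has_derivative_at_alt
  proof (intro conjI allI impI)
    show "bounded_linear (\<lambda>z. al z + cp * be z)"
      by (intro bounded_linear_add bounded_linear_al bounded_linear_const_mult bounded_linear_be)
    fix \<epsilon> :: real assume "\<epsilon> > 0"
    obtain \<delta>1 where \<delta>1: "\<delta>1 > 0"
      "\<And>z. 0 \<le> be z \<and> be z \<le> \<delta>1 * al z \<Longrightarrow> norm z \<le> al z + cp * be z + \<epsilon> * be z"
      using norm_le_right[OF \<open>\<epsilon> > 0\<close>] by auto
    obtain \<delta>2 where \<delta>2: "\<delta>2 > 0"
      "\<And>z. be z \<le> 0 \<and> - be z \<le> \<delta>2 * al z \<Longrightarrow> norm z \<le> al z + cm * be z - \<epsilon> * be z"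
      using norm_le_left[OF \<open>\<epsilon> > 0\<close>] by auto
    show "\<exists>d>0. \<forall>y. norm (y - x) < d \<longrightarrow>
        norm (norm y - norm x - (al (y - x) + cp * be (y - x))) \<le> \<epsilon> * norm (y - x)"
    \<comment> \<open>The bound \<open>1/4\<close> keeps \<open>al y \<ge> 1/2\<close>, because
      \<open>al\<close> is bounded by twice the norm; half of each \<open>\<delta>\<close> then puts
      \<open>y\<close> into both cones where the upper estimates hold.\<close>
    proof (intro exI[of _ "min (1/4) (min \<delta>1 \<delta>2 / 2)"] conjI allI impI)
      show "0 < min (1/4) (min \<delta>1 \<delta>2 / 2)" using \<delta>1 \<delta>2 by auto
      fix y assume y: "norm (y - x) < min (1/4) (min \<delta>1 \<delta>2 / 2)"
      have al: "al y \<ge> 1/2" using abs_al_le[of "y - x"] y by (auto simp: abs_le_iff)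
      have "\<bar>be y\<bar> \<le> norm (y - x)" using abs_be_le[of "y - x"] by simp
      then have be: "\<bar>be y\<bar> \<le> \<delta>1 / 2" "\<bar>be y\<bar> \<le> \<delta>2 / 2" using y by auto
      have "\<delta>1 / 2 \<le> \<delta>1 * al y" "\<delta>2 / 2 \<le> \<delta>2 * al y"
        using mult_left_mono[OF al, of \<delta>1] mult_left_mono[OF al, of \<delta>2] \<delta>1(1) \<delta>2(1) by auto
      then have "\<bar>be y\<bar> \<le> \<delta>1 * al y" "\<bar>be y\<bar> \<le> \<delta>2 * al y" using be by linarith+
      then have up: "norm y \<le> al y + cp * be y + \<epsilon> * \<bar>be y\<bar>"
        using \<delta>1(2)[of y] \<delta>2(2)[of y] assms by (cases "be y \<ge> 0") (simp_all add: abs_if)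
      have "\<epsilon> * \<bar>be y\<bar> \<le> \<epsilon> * norm (y - x)"
        using \<open>\<bar>be y\<bar> \<le> norm (y - x)\<close> \<open>\<epsilon> > 0\<close> by simp
      then show "norm (norm y - norm x - (al (y - x) + cp * be (y - x))) \<le> \<epsilon> * norm (y - x)"
        using up right_functional_le[of y] by simp
    qed
  qed
  then show ?thesis by (auto simp: differentiable_def)
qed

lemma slopes_less: "x \<in> nondiff_points \<Longrightarrow> cm < cp"
  using cm_le_cp norm_differentiable_if_slopes_eq by (fastforce simp: nondiff_points_def)

text \<open>Off the line through \<open>e\<close>, homogeneity expresses the norm by the convex
  function \<open>f\<close> of the slope \<open>be w / al w\<close>. A singular unit vector is
  therefore \<open>e\<close>, \<open>- e\<close>, or a normalised \<open>x + t *\<^sub>R e\<close>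
  up to sign with \<open>f\<close> not differentiable at \<open>t\<close>.\<close>

lemma countable_nondiff_points: "countable (nondiff_points :: 'a set)"
proof -
  define f where "f t = norm (x + t *\<^sub>R e)" for t
  have cvx: "convex_on {- real n<..<real n} f" for n
    unfolding f_def by (rule convex_on_norm_line) simp
  define N where "N = {t. \<not> f differentiable (at t)}"
  have "N \<subseteq> (\<Union>n. {t \<in> {- real n<..<real n}. \<not> f differentiable (at t)})"
  proof
    fix t assume t: "t \<in> N"
    obtain n where "\<bar>t\<bar> < real n" using reals_Archimedean2 by blast
    then show "t \<in> (\<Union>n. {t \<in> {- real n<..<real n}. \<not> f differentiable (at t)})"
      using t by (auto simp: N_def intro!: exI[of _ n])
  qed
  then have N: "countable N"
    by (rule countable_subset) (intro countable_UN countable_nondifferentiable_convex[OF cvx]; simp)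
  \<comment> \<open>The sign is frozen at that of a reference value \<open>a\<close>: near a vector
    with \<open>al z = a\<close> this replaces the absolute value of \<open>al w\<close> by a linear
    expression, so the chain rule applies.\<close>
  have polar: "norm w = sgn a * al w * f (be w / al w)" if "a * al w > 0" for a w
  proof -
    have "al w \<noteq> 0" using that by auto
    then have "w = al w *\<^sub>R (x + (be w / al w) *\<^sub>R e)"
      using decomp[of w] by (simp add: scaleR_add_right)
    then have "norm w = \<bar>al w\<bar> * f (be w / al w)" unfolding f_def by (metis norm_scaleR)
    moreover have "\<bar>al w\<bar> = sgn a * al w" using that
      by (auto simp: zero_less_mult_iff)
    ultimately show ?thesis by simp
  qed
  have "nondiff_points \<subseteq> {e, - e} \<union> (\<lambda>t. (1 / f t) *\<^sub>R (x + t *\<^sub>R e)) ` N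
      \<union> (\<lambda>t. - (1 / f t) *\<^sub>R (x + t *\<^sub>R e)) ` N"
  proof
    fix z :: 'a assume z: "z \<in> nondiff_points"
    then have nz: "norm z = 1" and nd: "\<not> norm differentiable (at z)"
      by (auto simp: nondiff_points_def unit_sphere_def)
    show "z \<in> {e, - e} \<union> (\<lambda>t. (1 / f t) *\<^sub>R (x + t *\<^sub>R e)) ` N
      \<union> (\<lambda>t. - (1 / f t) *\<^sub>R (x + t *\<^sub>R e)) ` N"
    proof (cases "al z = 0")
      case True
      then have "z = be z *\<^sub>R e" using decomp[of z] by simp
      moreover from this have "\<bar>be z\<bar> = 1" using nz by (metis mult.right_neutral norm_e norm_scaleR)
      ultimately show ?thesis by (cases "be z \<ge> 0") auto
    next
      case False
      define t where "t = be z / al z"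
      have zt: "z = al z *\<^sub>R (x + t *\<^sub>R e)"
        using decomp[of z] False by (simp add: scaleR_add_right t_def)
      have one: "\<bar>al z\<bar> * f t = 1" using nz zt unfolding f_def by (metis norm_scaleR)
      have "t \<in> N"
      proof (rule ccontr)
        assume "t \<notin> N"
        then have ft: "f differentiable (at t)" by (simp add: N_def)
        have dal: "al differentiable (at z)" and dbe: "be differentiable (at z)"
          using bounded_linear_al bounded_linear_be bounded_linear_imp_differentiable by auto
        have "(\<lambda>w. be w / al w) differentiable (at z)"
          using dal dbe False by (rule_tac differentiable_divide) auto
        then have "(f \<circ> (\<lambda>w. be w / al w)) differentiable (at z)"
          by (rule differentiable_chain_at) (use ft in \<open>simp add: t_def\<close>)
        then have "(\<lambda>w. sgn (al z) * al w * f (be w / al w)) differentiable (at z)"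
          using dal by (intro differentiable_mult) (auto simp: o_def)
        moreover have "\<forall>\<^sub>F w in nhds z. al z * al w > 0"
        proof -
          have "open {w. 0 < al z * al w}"
            by (intro open_Collect_less continuous_intros linear_continuous_on bounded_linear_al)
          then show ?thesis using False by (auto simp: eventually_nhds intro!: exI[of _ "{w. 0 < al z * al w}"] simp: zero_less_mult_iff)
        qed
        then obtain S where S: "open S" "z \<in> S" "\<And>w. w \<in> S \<Longrightarrow> al z * al w > 0"
          by (auto simp: eventually_nhds)
        ultimately obtain D where "((\<lambda>w. sgn (al z) * al w * f (be w / al w)) has_derivative D) (at z)"
          by (auto simp: differentiable_def)
        then have "(norm has_derivative D) (at z)"
          by (rule has_derivative_transform_within_open[OF _ S(1,2)]) (simp add: polar[OF S(3)])
        then have "norm differentiable (at z)" by (auto simp: differentiable_def)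
        then show False using nd by simp
      qed
      have "f t \<noteq> 0" using one by auto
      have "al z = 1 / f t \<or> al z = - (1 / f t)"
        using one \<open>f t \<noteq> 0\<close> by (cases "al z \<ge> 0") (auto simp: field_simps)
      then show ?thesis
      proof
        assume "al z = 1 / f t"
        then have "z = (1 / f t) *\<^sub>R (x + t *\<^sub>R e)" using zt by metis
        then show ?thesis using \<open>t \<in> N\<close> by blast
      next
        assume "al z = - (1 / f t)"
        then have "z = - (1 / f t) *\<^sub>R (x + t *\<^sub>R e)" using zt by metis
        then show ?thesis using \<open>t \<in> N\<close> by blast
      qed
    qed
  qed
  then show ?thesis by (rule countable_subset) (use N in auto)
qed

end

lemma obtain_coordinates:
  fixes x :: "'a::real_normed_vector"
  assumes dim: "dim (UNIV :: 'a set) = 2" and "x \<noteq> 0"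
  obtains f :: 'a and p q where "linear p" "linear q" "\<And>z. z = p z *\<^sub>R x + q z *\<^sub>R f"
    "p x = 1" "q x = 0" "p f = 0" "q f = 1"
proof -
  obtain B where B: "{x} \<subseteq> B" "independent B" "UNIV \<subseteq> span B"
    using maximal_independent_subset_extend[of "{x}" UNIV] \<open>x \<noteq> 0\<close> by (auto simp: dependent_single)
  have "card B = 2" using dim_eq_card[of B UNIV] B dim by auto
  then obtain f where f: "B = {x, f}" "f \<noteq> x" using B(1)
    by (auto simp: card_2_iff)
  have span: "z \<in> span B" for z using B by auto
  define R where "R = representation B"
  have R: "R (u + v) b = R u b + R v b" "R (c *\<^sub>R u) b = c * R u b" for u v b c
    unfolding R_def using representation_add[OF B(2) span span] representation_scale[OF B(2) span] by auto
  have z: "z = R z x *\<^sub>R x + R z f *\<^sub>R f" for z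
  proof -
    have "(\<Sum>b\<in>B. R z b *\<^sub>R b) = z"
      unfolding R_def by (rule sum_representation_eq[OF B(2) span]) (use f in auto)
    then show ?thesis using f by simp
  qed
  have basis: "R b b' = (if b' = b then 1 else 0)" if "b \<in> B" for b b'
    unfolding R_def using representation_basis[OF B(2) that] by auto
  show thesis
    by (rule that[of "\<lambda>z. R z x" "\<lambda>z. R z f" f])
      (use R z f basis in \<open>auto intro!: linearI\<close>)
qed

text \<open>The vector \<open>e\<close> is the normalised point of least norm on a line parallel to
  \<open>x\<close>, that is, \<open>e\<close> is Birkhoff orthogonal to \<open>x\<close>. This
  minimality is exactly the bound of \<open>be\<close> by the norm.\<close>

lemma sphere_frame_exists:
  fixes x :: "'a::real_normed_vector"
  assumes dim: "dim (UNIV :: 'a set) = 2" and x: "norm x = 1"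
  obtains e al be cm cp where "sphere_frame x e al be cm cp"
proof -
  obtain f :: 'a and p q where pq: "linear p" "linear q" "\<And>z. z = p z *\<^sub>R x + q z *\<^sub>R f"
    "p x = 1" "q x = 0" "p f = 0" "q f = 1"
    using obtain_coordinates[OF dim, of x] x by force
  \<comment> \<open>Beyond \<open>2 * norm f\<close> the triangle inequality gives a norm larger
    than \<open>norm f\<close>, the value at \<open>a = 0\<close>, so a minimum over this compact
    interval is global.\<close>
  have "continuous_on {- (2 * norm f)..2 * norm f} (\<lambda>a. norm (a *\<^sub>R x + f))"
    by (intro continuous_intros)
  then have "\<exists>a0\<in>{- (2 * norm f)..2 * norm f}. \<forall>a\<in>{- (2 * norm f)..2 * norm f}.
      norm (a0 *\<^sub>R x + f) \<le> norm (a *\<^sub>R x + f)"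
    by (intro continuous_attains_inf) auto
  then obtain a0 where a0: "\<And>a. a \<in> {- (2 * norm f)..2 * norm f} \<Longrightarrow> norm (a0 *\<^sub>R x + f) \<le> norm (a *\<^sub>R x + f)"
    by blast
  define d where "d = norm (a0 *\<^sub>R x + f)"
  have dmin: "d \<le> norm (a *\<^sub>R x + f)" for a
  proof (cases "\<bar>a\<bar> \<le> 2 * norm f")
    case True
    then have "a \<in> {- (2 * norm f)..2 * norm f}" by auto
    then show ?thesis using a0 by (simp add: d_def)
  next
    case False
    have "\<bar>a\<bar> - norm f \<le> norm (a *\<^sub>R x + f)"
      using norm_diff_ineq[of "a *\<^sub>R x" f] x by simp
    then show ?thesis using a0[of 0] False by (simp add: d_def)
  qed
  have "d > 0"
  proof -
    have "q (a0 *\<^sub>R x + f) = 1" using pq by (simp add: linear_add linear_scale)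
    then have "a0 *\<^sub>R x + f \<noteq> 0" using pq(2) linear_0 by force
    then show ?thesis by (simp add: d_def)
  qed
  define e where "e = (1 / d) *\<^sub>R (a0 *\<^sub>R x + f)"
  define be where "be z = d * q z" for z
  define al where "al z = p z - a0 * q z" for z
  have lin: "linear al" "linear be"
    unfolding al_def be_def using pq(1,2)
    by (auto intro!: linearI simp: linear_add linear_scale algebra_simps)
  have ab: "al x = 1" "be x = 0" "al e = 0" "be e = 1"
    using pq(1,2,4-) \<open>d > 0\<close> by (auto simp: al_def be_def e_def linear_add linear_scale)
  have e: "norm e = 1" using \<open>d > 0\<close> by (simp add: e_def d_def)
  have dec: "z = al z *\<^sub>R x + be z *\<^sub>R e" for z
    using pq(3)[of z] \<open>d > 0\<close> by (simp add: al_def be_def e_def algebra_simps)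
  have ble: "\<bar>be z\<bar> \<le> norm z" for z
  proof (cases "q z = 0")
    case False
    have "norm z = norm (q z *\<^sub>R ((p z / q z) *\<^sub>R x + f))"
      using pq(3)[of z] False by (simp add: scaleR_add_right)
    also have "\<dots> = \<bar>q z\<bar> * norm ((p z / q z) *\<^sub>R x + f)" by simp
    also have "\<dots> \<ge> \<bar>q z\<bar> * d" using dmin by (intro mult_left_mono) auto
    finally show ?thesis using \<open>d > 0\<close> by (simp add: be_def abs_mult mult.commute)
  qed (simp add: be_def)
  \<comment> \<open>From here on \<open>f\<close> is the norm along the line through
    \<open>x\<close> in direction \<open>e\<close>; it shadows the basis vector used so far.\<close>
  define f where "f t = norm (x + t *\<^sub>R e)" for t
  have cvx: "convex_on {-1<..<1} f"
    unfolding f_def by (rule convex_on_norm_line) simp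
  have f0: "f 0 = 1" using x by (simp add: f_def)
  obtain cm cp where c: "cm \<le> cp"
    "\<And>s. s \<in> {-1<..<1} \<Longrightarrow> cm * s \<le> f s - 1"
    "\<And>s. s \<in> {-1<..<1} \<Longrightarrow> cp * s \<le> f s - 1"
    "\<And>\<epsilon>. \<epsilon> > 0 \<Longrightarrow> \<exists>\<delta>>0. \<forall>s. 0 < s \<and> s < \<delta> \<longrightarrow> f s - 1 \<le> (cp + \<epsilon>) * s"
    "\<And>\<epsilon>. \<epsilon> > 0 \<Longrightarrow> \<exists>\<delta>>0. \<forall>s. -\<delta> < s \<and> s < 0 \<longrightarrow> f s - 1 \<le> (cm - \<epsilon>) * s"
    using convex_on_one_sided_slopes[OF cvx, of 0] f0 by auto
  have polar: "norm z = al z * f (be z / al z)" if "al z > 0" for z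
  proof -
    have "z = al z *\<^sub>R (x + (be z / al z) *\<^sub>R e)"
      using dec[of z] that by (simp add: scaleR_add_right)
    then show ?thesis using that unfolding f_def by (metis abs_of_pos norm_scaleR)
  qed
  \<comment> \<open>The slope inequality is only known on the cone of vectors whose slope lies
    between \<open>-1\<close> and \<open>1\<close>. Adding \<open>R *\<^sub>R x\<close> moves
    \<open>z\<close> into it, and \<open>R\<close> cancels because the norm grows by at most
    \<open>R\<close>.\<close>
  have func: "al z + c * be z \<le> norm z" if c: "\<And>s. s \<in> {-1<..<1} \<Longrightarrow> c * s \<le> f s - 1" for c z
  proof -
    define R where "R = \<bar>al z\<bar> + \<bar>be z\<bar> + 1"
    define w where "w = z + R *\<^sub>R x"
    have w: "al w = al z + R" "be w = be z" using lin ab by (auto simp: w_def linear_add linear_scale)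
    have pos: "al w > \<bar>be w\<bar>" using w by (auto simp: R_def)
    then have "be w / al w \<in> {-1<..<1}" by (auto simp: field_simps)
    then have "c * (be w / al w) \<le> f (be w / al w) - 1" by (rule c)
    then have "al w * (c * (be w / al w)) \<le> al w * (f (be w / al w) - 1)"
      using pos by (intro mult_left_mono) auto
    moreover have "al w > 0" using pos by linarith
    ultimately have "c * be w \<le> norm w - al w" using polar[of w] by (simp add: algebra_simps)
    moreover have "norm w \<le> norm z + R"
      unfolding w_def using norm_triangle_ineq[of z "R *\<^sub>R x"] x by (simp add: R_def)
    ultimately show ?thesis using w by simp
  qed
  have zero: "norm z = al z" if "be z = 0" "al z \<ge> 0" for z
    using dec[of z] that x by (metis abs_of_nonneg add.right_neutral mult.right_neutral norm_scaleR scaleR_zero_left)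
  have "sphere_frame x e al be cm cp"
  proof
    fix \<epsilon> :: real assume "\<epsilon> > 0"
    obtain \<delta> where \<delta>: "\<delta> > 0" "\<And>s. 0 < s \<and> s < \<delta> \<Longrightarrow> f s - 1 \<le> (cp + \<epsilon>) * s"
      using c(4)[OF \<open>\<epsilon> > 0\<close>] by auto
    \<comment> \<open>Halving \<open>\<delta>\<close> turns the weak inequality defining the cone
      into the strict one under which the slope estimate holds.\<close>
    show "\<exists>\<delta>>0. \<forall>z. 0 \<le> be z \<and> be z \<le> \<delta> * al z \<longrightarrow> norm z \<le> al z + cp * be z + \<epsilon> * be z"
    proof (intro exI[of _ "\<delta> / 2"] conjI allI impI)
      fix z assume z: "0 \<le> be z \<and> be z \<le> \<delta> / 2 * al z"
      then have "al z \<ge> 0" using \<delta>(1) by (metis dual_order.trans half_gt_zero zero_le_mult_iff not_less)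
      show "norm z \<le> al z + cp * be z + \<epsilon> * be z"
      proof (cases "be z = 0")
        case False
        then have p: "al z > 0" "be z > 0" using z \<open>al z \<ge> 0\<close> by (cases "al z = 0"; simp)+
        have "be z < \<delta> * al z" using z p \<delta>(1) by (simp add: field_simps)
        then have "f (be z / al z) - 1 \<le> (cp + \<epsilon>) * (be z / al z)"
          using p by (intro \<delta>(2)) (auto simp: field_simps)
        then have "al z * (f (be z / al z) - 1) \<le> al z * ((cp + \<epsilon>) * (be z / al z))"
          using p by (intro mult_left_mono) auto
        also have "\<dots> = (cp + \<epsilon>) * be z" using p by simp
        finally show ?thesis using polar[OF p(1)] by (simp add: algebra_simps)
      qed (use zero \<open>al z \<ge> 0\<close> in auto)
    qed (use \<delta> in auto)
    obtain \<delta> where \<delta>: "\<delta> > 0" "\<And>s. -\<delta> < s \<and> s < 0 \<Longrightarrow> f s - 1 \<le> (cm - \<epsilon>) * s"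
      using c(5)[OF \<open>\<epsilon> > 0\<close>] by auto
    show "\<exists>\<delta>>0. \<forall>z. be z \<le> 0 \<and> - be z \<le> \<delta> * al z \<longrightarrow> norm z \<le> al z + cm * be z - \<epsilon> * be z"
    proof (intro exI[of _ "\<delta> / 2"] conjI allI impI)
      fix z assume z: "be z \<le> 0 \<and> - be z \<le> \<delta> / 2 * al z"
      then have "0 \<le> \<delta> / 2 * al z" by linarith
      then have "al z \<ge> 0" using \<delta>(1) by (simp add: zero_le_mult_iff)
      show "norm z \<le> al z + cm * be z - \<epsilon> * be z"
      proof (cases "be z = 0")
        case False
        then have p: "al z > 0" "be z < 0" using z \<open>al z \<ge> 0\<close> by (cases "al z = 0"; simp)+
        have "- be z < \<delta> * al z" using z p \<delta>(1) by (simp add: field_simps)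
        then have "f (be z / al z) - 1 \<le> (cm - \<epsilon>) * (be z / al z)"
          using p by (intro \<delta>(2)) (auto simp: field_simps)
        then have "al z * (f (be z / al z) - 1) \<le> al z * ((cm - \<epsilon>) * (be z / al z))"
          using p by (intro mult_left_mono) auto
        also have "\<dots> = (cm - \<epsilon>) * be z" using p by simp
        finally show ?thesis using polar[OF p(1)] by (simp add: algebra_simps)
      qed (use zero \<open>al z \<ge> 0\<close> in auto)
    qed (use \<delta> in auto)
  qed (use lin ab e x dec ble c func in \<open>auto simp: linear_add linear_scale\<close>)
  then show thesis by (rule that)
qed

section \<open>The arcs of the unit sphere\<close>

text \<open>Upper end of the slice of the unit ball parallel to \<open>x\<close> at coordinate
  \<open>b\<close>. By central symmetry the lower end of the same slice is
  \<open>- sphere_arc x e (- b)\<close>, so one function describes both arcs.\<close>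

definition arc_height :: "'a::real_normed_vector \<Rightarrow> 'a \<Rightarrow> real \<Rightarrow> real" where
  "arc_height x e b = Sup {a. norm (a *\<^sub>R x + b *\<^sub>R e) \<le> 1}"

definition sphere_arc :: "'a::real_normed_vector \<Rightarrow> 'a \<Rightarrow> real \<Rightarrow> 'a" where
  "sphere_arc x e b = arc_height x e b *\<^sub>R x + b *\<^sub>R e"

lemma arc_height_reflect: "arc_height x (- e) b = arc_height x e (- b)"
  by (simp add: arc_height_def)

lemma sphere_arc_reflect: "sphere_arc x (- e) b = sphere_arc x e (- b)"
  by (simp add: sphere_arc_def arc_height_reflect)

context sphere_frame
begin

abbreviation height :: "real \<Rightarrow> real" where "height \<equiv> arc_height x e"
abbreviation curve :: "real \<Rightarrow> 'a" where "curve \<equiv> sphere_arc x e"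

lemma al_curve [simp]: "al (curve b) = height b" and be_curve [simp]: "be (curve b) = b"
  by (simp_all add: sphere_arc_def)

lemma height_bound: "norm (a *\<^sub>R x + b *\<^sub>R e) \<le> 1 \<Longrightarrow> a \<le> 2"
  using abs_al_le[of "a *\<^sub>R x + b *\<^sub>R e"] by simp

lemma le_height: "norm (a *\<^sub>R x + b *\<^sub>R e) \<le> 1 \<Longrightarrow> a \<le> height b"
  unfolding arc_height_def by (rule cSup_upper) (auto intro!: bdd_aboveI dest: height_bound)

lemma al_le_height: "norm z \<le> 1 \<Longrightarrow> al z \<le> height (be z)"
  using le_height[of "al z" "be z"] decomp[of z] by simp

lemma height_ge: "\<bar>b\<bar> \<le> 1 \<Longrightarrow> 1 - \<bar>b\<bar> \<le> height b"
proof (rule le_height)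
  assume "\<bar>b\<bar> \<le> 1"
  then show "norm ((1 - \<bar>b\<bar>) *\<^sub>R x + b *\<^sub>R e) \<le> 1"
    using norm_triangle_ineq[of "(1 - \<bar>b\<bar>) *\<^sub>R x" "b *\<^sub>R e"] by simp
qed

lemma height_pos: "\<bar>b\<bar> < 1 \<Longrightarrow> 0 < height b"
  using height_ge[of b] by simp

text \<open>The supremum is attained since the slice is closed, and a point with norm below one
  could be pushed further along \<open>x\<close> by the slack \<open>d\<close>.\<close>

lemma norm_curve:
  assumes "\<bar>b\<bar> \<le> 1"
  shows "norm (curve b) = 1"
proof -
  let ?S = "{a. norm (a *\<^sub>R x + b *\<^sub>R e) \<le> 1}"
  have "closed ?S" by (intro closed_Collect_le continuous_intros)
  moreover have "0 \<in> ?S" using assms by simp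
  ultimately have "height b \<in> ?S"
    unfolding arc_height_def
    by (intro closed_contains_Sup bdd_aboveI[of _ 2]) (blast intro: height_bound)+
  then have le: "norm (curve b) \<le> 1" by (simp add: sphere_arc_def)
  define d where "d = 1 - norm (curve b)"
  have "norm (curve b + d *\<^sub>R x) \<le> 1"
    using norm_triangle_ineq[of "curve b" "d *\<^sub>R x"] le by (simp add: d_def)
  then have "al (curve b + d *\<^sub>R x) \<le> height b"
    using al_le_height by fastforce
  then show ?thesis using le by (simp add: d_def)
qed

text \<open>With lower end \<open>- curve (- b)\<close>, this sum is the vector of the chord at
  \<open>b\<close>.\<close>

lemma chord: "curve b + curve (- b) = (height b + height (- b)) *\<^sub>R x"
  by (simp add: sphere_arc_def algebra_simps)

lemma convex_on_neg_height: "convex_on {-1<..<1} (\<lambda>b. - height b)"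
proof (intro convex_onI)
  fix u s t :: real assume u: "0 < u" "u < 1" and st: "s \<in> {-1<..<1}" "t \<in> {-1<..<1}"
  let ?z = "(1 - u) *\<^sub>R curve s + u *\<^sub>R curve t"
  have "norm ?z \<le> (1 - u) * norm (curve s) + u * norm (curve t)"
    using norm_triangle_ineq[of "(1 - u) *\<^sub>R curve s" "u *\<^sub>R curve t"] u by simp
  also have "\<dots> = 1" using st norm_curve[of s] norm_curve[of t] by (simp add: abs_le_iff)
  finally have "al ?z \<le> height (be ?z)" by (rule al_le_height)
  then show "- height ((1 - u) *\<^sub>R s + u *\<^sub>R t) \<le> (1 - u) * - height s + u * - height t"
    by simp
qed simp

lemma continuous_on_height: "continuous_on {-1<..<1} height"
  using continuous_on_minus[OF convex_on_continuous[OF _ convex_on_neg_height]] by simp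

lemma continuous_on_curve: "continuous_on {-1<..<1} curve"
  unfolding sphere_arc_def by (intro continuous_intros continuous_on_height)

lemma countable_nondifferentiable_height:
  "countable {b \<in> {-1<..<1}. \<not> height differentiable (at b)}"
proof (rule countable_subset[OF _ countable_nondifferentiable_convex[OF convex_on_neg_height]])
  have "height differentiable (at b)" if "(\<lambda>b. - height b) differentiable (at b)" for b
    using differentiable_minus[OF that] by simp
  then show "{b \<in> {-1<..<1}. \<not> height differentiable (at b)}
    \<subseteq> {t \<in> {-1<..<1}. \<not> (\<lambda>b. - height b) differentiable (at t)}" by blast
qed

lemma curve_right_lipschitz:
  assumes "t \<in> {-1<..<1}"
  obtains L \<eta> where "\<eta> > 0" "L > 0" "\<And>s. t < s \<Longrightarrow> s < t + \<eta> \<Longrightarrow> norm (curve s - curve t) \<le> L * (s - t)"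
proof -
  obtain p q where pq: "p \<le> q"
    "\<And>s. s \<in> {-1<..<1} \<Longrightarrow> p * (s - t) \<le> - height s - - height t"
    "\<And>s. s \<in> {-1<..<1} \<Longrightarrow> q * (s - t) \<le> - height s - - height t"
    "\<And>\<epsilon>. \<epsilon> > 0 \<Longrightarrow> \<exists>\<delta>>0. \<forall>s. t < s \<and> s < t + \<delta> \<longrightarrow> - height s - - height t \<le> (q + \<epsilon>) * (s - t)"
    "\<And>\<epsilon>. \<epsilon> > 0 \<Longrightarrow> \<exists>\<delta>>0. \<forall>s. t - \<delta> < s \<and> s < t \<longrightarrow> - height s - - height t \<le> (p - \<epsilon>) * (s - t)"
    using convex_on_one_sided_slopes[OF convex_on_neg_height assms] by blast
  obtain \<delta> where \<delta>: "\<delta> > 0" "\<And>s. t < s \<and> s < t + \<delta> \<Longrightarrow> - height s - - height t \<le> (q + 1) * (s - t)"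
    using pq(4)[of 1] by auto
  show thesis
  \<comment> \<open>Here \<open>\<bar>q\<bar> + 1\<close> bounds the change of height and the
    remaining \<open>1\<close> pays for the component along \<open>e\<close>; \<open>1 - t\<close>
    keeps \<open>s\<close> inside the domain.\<close>
  proof (rule that[of "min \<delta> (1 - t)" "\<bar>q\<bar> + 2"])
    fix s assume s: "t < s" "s < t + min \<delta> (1 - t)"
    have "\<bar>height s - height t\<bar> \<le> (\<bar>q\<bar> + 1) * (s - t)"
    proof -
      have 1: "- height s - - height t \<le> (q + 1) * (s - t)" using \<delta>(2)[of s] s by auto
      have 2: "q * (s - t) \<le> - height s - - height t" using pq(3)[of s] s assms by auto
      have 3: "(q + 1) * (s - t) \<le> (\<bar>q\<bar> + 1) * (s - t)" "(- (\<bar>q\<bar> + 1)) * (s - t) \<le> q * (s - t)"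
        using s by (intro mult_right_mono; simp)+
      show ?thesis using 1 2 3 unfolding abs_le_iff mult_minus_left by linarith
    qed
    moreover have "curve s - curve t = (height s - height t) *\<^sub>R x + (s - t) *\<^sub>R e"
      by (simp add: sphere_arc_def algebra_simps)
    then have "norm (curve s - curve t) \<le> \<bar>height s - height t\<bar> + (s - t)"
      using norm_triangle_ineq[of "(height s - height t) *\<^sub>R x" "(s - t) *\<^sub>R e"] s by simp
    ultimately show "norm (curve s - curve t) \<le> (\<bar>q\<bar> + 2) * (s - t)" by (simp add: algebra_simps)
  qed (use \<delta> assms in auto)
qed

end

section \<open>Second differences along the sphere\<close>

lemma tendsto_at_0_uminus:
  fixes f :: "real \<Rightarrow> 'a::topological_space"
  assumes "(f \<longlongrightarrow> l) (at 0)"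
  shows "((\<lambda>h. f (- h)) \<longlongrightarrow> l) (at 0)"
  using assms filterlim_filtermap[of f "nhds l" uminus "at (0::real)"] filtermap_at_minus[of "0::real"]
  by simp

text \<open>The direction may vary with \<open>h\<close> without converging: boundedness suffices
  for the error of the derivative to stay \<open>o(h)\<close>. This serves directions taken from the
  image curve, whose limit is unknown.\<close>

lemma has_derivative_moving_direction:
  fixes f :: "'a::real_normed_vector \<Rightarrow> real" and u :: "real \<Rightarrow> 'a"
  assumes D: "(f has_derivative D) (at q)" and M: "\<forall>\<^sub>F h in at 0. norm (u h) \<le> M"
  shows "((\<lambda>h. (f (q + h *\<^sub>R u h) - f q) / h - D (u h)) \<longlongrightarrow> 0) (at 0)"
proof (rule tendstoI)
  fix \<epsilon> :: real assume "\<epsilon> > 0"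
  define e where "e = \<epsilon> / (\<bar>M\<bar> + 1) / 2"
  have "e > 0" using \<open>\<epsilon> > 0\<close> by (simp add: e_def)
  have blD: "bounded_linear D" using D by (rule has_derivative_bounded_linear)
  obtain d where d: "d > 0" "\<And>y. norm (y - q) < d \<Longrightarrow> norm (f y - f q - D (y - q)) \<le> e * norm (y - q)"
    using D \<open>e > 0\<close> unfolding has_derivative_at_alt by blast
  have "\<forall>\<^sub>F h in at (0::real). h \<noteq> 0 \<and> \<bar>h\<bar> < d / (\<bar>M\<bar> + 1)"
    unfolding eventually_at using d(1) by (intro exI[of _ "d / (\<bar>M\<bar> + 1)"]) auto
  then show "\<forall>\<^sub>F h in at 0. dist ((f (q + h *\<^sub>R u h) - f q) / h - D (u h)) 0 < \<epsilon>"
    using M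
  proof eventually_elim
    case (elim h)
    then have h: "h \<noteq> 0" "\<bar>h\<bar> < d / (\<bar>M\<bar> + 1)" and u: "norm (u h) \<le> \<bar>M\<bar>" by auto
    have "norm (h *\<^sub>R u h) \<le> \<bar>h\<bar> * (\<bar>M\<bar> + 1)" using u by (auto intro!: mult_left_mono)
    also have "\<dots> < d" using h by (simp add: field_simps)
    finally have "norm (f (q + h *\<^sub>R u h) - f q - D (h *\<^sub>R u h)) \<le> e * norm (h *\<^sub>R u h)"
      using d(2)[of "q + h *\<^sub>R u h"] by simp
    then have le: "\<bar>f (q + h *\<^sub>R u h) - f q - h * D (u h)\<bar> \<le> e * norm (u h) * \<bar>h\<bar>"
      using linear_scale[OF bounded_linear.linear[OF blD]] by (simp add: mult_ac)
    have "(f (q + h *\<^sub>R u h) - f q) / h - D (u h) = (f (q + h *\<^sub>R u h) - f q - h * D (u h)) / h"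
      using h by (simp add: field_simps)
    then have "\<bar>(f (q + h *\<^sub>R u h) - f q) / h - D (u h)\<bar> \<le> e * norm (u h)"
      using le h by (simp add: field_simps)
    also have "\<dots> \<le> e * (\<bar>M\<bar> + 1)" using u \<open>e > 0\<close> by simp
    also have "\<dots> < \<epsilon>" using \<open>\<epsilon> > 0\<close> by (simp add: e_def field_simps add_pos_nonneg)
    finally show ?case by simp
  qed
qed

text \<open>Near a point of differentiability the sphere is almost a segment, so two chords of asymptotic
  length \<open>w\<close> whose other ends are \<open>2 w\<close> apart must be asymptotically opposite.\<close>

lemma opposite_directions:
  fixes p :: "'b::real_normed_vector" and u :: "real \<Rightarrow> 'b"
  assumes dim: "dim (UNIV :: 'b set) = 2" and p: "norm p = 1" and diff: "norm differentiable (at p)"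
    and on: "\<forall>\<^sub>F h in at 0. norm (p + h *\<^sub>R u h) = 1"
    and lim1: "((\<lambda>h. norm (u h)) \<longlongrightarrow> w) (at 0)"
    and lim2: "((\<lambda>h. norm (u h + u (- h))) \<longlongrightarrow> 2 * w) (at 0)"
  shows "((\<lambda>h. u h - u (- h)) \<longlongrightarrow> 0) (at 0)"
proof -
  obtain D where D: "(norm has_derivative D) (at p)" using diff by (auto simp: differentiable_def)
  then have blD: "bounded_linear D" by (rule has_derivative_bounded_linear)
  note linD = linear_add[OF bounded_linear.linear[OF blD]] linear_scale[OF bounded_linear.linear[OF blD]]
  obtain e al be cm cp where fr: "sphere_frame p e al be cm cp" using sphere_frame_exists[OF dim p] .
  then interpret sphere_frame p e al be cm cp .
  have Dp: "D p = 1"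
  proof -
    have "((\<lambda>h. (norm (p + h *\<^sub>R p) - norm p) / h - D p) \<longlongrightarrow> 0) (at 0)"
      by (rule has_derivative_moving_direction[OF D, of "\<lambda>_. p" 1]) (simp add: p)
    moreover have "\<forall>\<^sub>F h in at (0::real). (norm (p + h *\<^sub>R p) - norm p) / h - D p = 1 - D p"
      unfolding eventually_at
    proof (intro exI[of _ 1] conjI ballI impI)
      fix h :: real assume h: "h \<noteq> 0 \<and> dist h 0 < 1"
      have "p + h *\<^sub>R p = (1 + h) *\<^sub>R p" by (simp add: algebra_simps)
      then have "norm (p + h *\<^sub>R p) = 1 + h" using h p by (simp add: dist_norm abs_less_iff)
      then show "(norm (p + h *\<^sub>R p) - norm p) / h - D p = 1 - D p" using h p by simp
    qed simp
    ultimately have "((\<lambda>h::real. 1 - D p) \<longlongrightarrow> 0) (at 0)" by (rule Lim_transform_eventually)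
    then show ?thesis by (simp add: tendsto_const_iff)
  qed
  \<comment> \<open>Since \<open>D p = 1\<close>, this \<open>k\<close> spans the kernel of
    \<open>D\<close>, the tangent direction at \<open>p\<close>; \<open>be\<close> remains the
    coordinate along it.\<close>
  define k where "k = e - D e *\<^sub>R p"
  have dec: "z = D z *\<^sub>R p + be z *\<^sub>R k" for z
  proof -
    have "D z = al z + be z * D e" using arg_cong[OF decomp[of z], of D] by (simp add: linD Dp)
    then have "D z *\<^sub>R p + be z *\<^sub>R k = al z *\<^sub>R p + be z *\<^sub>R e" by (simp add: k_def algebra_simps)
    then show ?thesis using decomp[of z] by simp
  qed
  have "\<forall>\<^sub>F h in at 0. norm (u h) < w + 1" using lim1 by (rule order_tendstoD) simp
  then have bdd: "\<forall>\<^sub>F h in at 0. norm (u h) \<le> w + 1" by (rule eventually_mono) simp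
  \<comment> \<open>The moving point stays on the sphere, so its difference quotient of the norm is
    zero and \<open>D (u h)\<close> must vanish in the limit.\<close>
  have "((\<lambda>h. - ((norm (p + h *\<^sub>R u h) - norm p) / h - D (u h))) \<longlongrightarrow> 0) (at 0)"
    using tendsto_minus[OF has_derivative_moving_direction[OF D bdd]] by simp
  moreover have "\<forall>\<^sub>F h in at 0. - ((norm (p + h *\<^sub>R u h) - norm p) / h - D (u h)) = D (u h)"
    using on by eventually_elim (simp add: p)
  ultimately have Du: "((\<lambda>h. D (u h)) \<longlongrightarrow> 0) (at 0)" by (rule Lim_transform_eventually)
  note Du' = tendsto_at_0_uminus[OF Du]
  define \<sigma> where "\<sigma> h = be (u h) * norm k" for h
  \<comment> \<open>Once the \<open>p\<close>-component tends to zero, the length of the tangential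
    component has the same limit as the whole norm.\<close>
  have near: "((\<lambda>h. \<bar>be (v h) * norm k\<bar>) \<longlongrightarrow> c) (at 0)"
    if v: "((\<lambda>h. norm (v h)) \<longlongrightarrow> c) (at 0)" and Dv: "((\<lambda>h. D (v h)) \<longlongrightarrow> 0) (at 0)" for v :: "real \<Rightarrow> 'b" and c
  proof -
    have "((\<lambda>h. \<bar>be (v h) * norm k\<bar> - norm (v h)) \<longlongrightarrow> 0) (at 0)"
    proof (rule Lim_null_comparison[OF always_eventually])
      show "((\<lambda>h. \<bar>D (v h)\<bar>) \<longlongrightarrow> 0) (at 0)" using Dv by (rule tendsto_rabs_zero)
      show "\<forall>h. norm (\<bar>be (v h) * norm k\<bar> - norm (v h)) \<le> \<bar>D (v h)\<bar>"
      proof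
        fix h
        have "be (v h) *\<^sub>R k - v h = - D (v h) *\<^sub>R p" using dec[of "v h"] by (simp add: algebra_simps)
        then have "norm (be (v h) *\<^sub>R k - v h) = \<bar>D (v h)\<bar>" using p by simp
        then show "norm (\<bar>be (v h) * norm k\<bar> - norm (v h)) \<le> \<bar>D (v h)\<bar>"
          using norm_triangle_ineq3[of "be (v h) *\<^sub>R k" "v h"] by (simp add: abs_mult)
      qed
    qed
    from tendsto_add[OF this v] show ?thesis by simp
  qed
  have s1: "((\<lambda>h. \<bar>\<sigma> h\<bar>) \<longlongrightarrow> w) (at 0)" unfolding \<sigma>_def by (rule near[OF lim1 Du])
  note s2 = tendsto_at_0_uminus[OF s1]
  have "((\<lambda>h. D (u h + u (- h))) \<longlongrightarrow> 0) (at 0)"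
    using tendsto_add[OF Du Du'] by (simp add: linD)
  from near[OF lim2 this] have s3: "((\<lambda>h. \<bar>\<sigma> h + \<sigma> (- h)\<bar>) \<longlongrightarrow> 2 * w) (at 0)"
    by (simp add: \<sigma>_def algebra_simps)
  \<comment> \<open>The parallelogram identity on the line turns the limits of
    \<open>\<bar>\<sigma> h\<bar>\<close>, \<open>\<bar>\<sigma> (- h)\<bar>\<close> and the
    absolute value of their signed sum into the limit of the squared difference.\<close>
  have "((\<lambda>h. 2 * \<bar>\<sigma> h\<bar>\<^sup>2 + 2 * \<bar>\<sigma> (- h)\<bar>\<^sup>2 - \<bar>\<sigma> h + \<sigma> (- h)\<bar>\<^sup>2) \<longlongrightarrow> 2 * w\<^sup>2 + 2 * w\<^sup>2 - (2 * w)\<^sup>2) (at 0)"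
    by (intro tendsto_intros s1 s2 s3)
  moreover have "2 * \<bar>\<sigma> h\<bar>\<^sup>2 + 2 * \<bar>\<sigma> (- h)\<bar>\<^sup>2 - \<bar>\<sigma> h + \<sigma> (- h)\<bar>\<^sup>2 = (\<sigma> h - \<sigma> (- h))\<^sup>2" for h
    by (simp add: power2_eq_square algebra_simps)
  ultimately have "((\<lambda>h. (\<sigma> h - \<sigma> (- h))\<^sup>2) \<longlongrightarrow> 0) (at 0)" by (simp add: power2_eq_square)
  then have "((\<lambda>h. \<sigma> h - \<sigma> (- h)) \<longlongrightarrow> 0) (at 0)"
    using tendsto_real_sqrt[of "\<lambda>h. (\<sigma> h - \<sigma> (- h))\<^sup>2" 0 "at 0"] by (simp add: tendsto_rabs_zero_iff)
  then have "((\<lambda>h. \<bar>D (u h) - D (u (- h))\<bar> + \<bar>\<sigma> h - \<sigma> (- h)\<bar>) \<longlongrightarrow> 0) (at 0)"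
    using tendsto_diff[OF Du Du'] by (intro tendsto_add_zero tendsto_rabs_zero) simp_all
  then show ?thesis
  proof (rule Lim_null_comparison[OF always_eventually, rotated], intro allI)
    fix h
    have "u h - u (- h) = (D (u h) - D (u (- h))) *\<^sub>R p + (be (u h) - be (u (- h))) *\<^sub>R k"
      using dec[of "u h"] dec[of "u (- h)"] by (simp add: algebra_simps)
    moreover have "norm ((be (u h) - be (u (- h))) *\<^sub>R k) = \<bar>\<sigma> h - \<sigma> (- h)\<bar>"
      by (simp add: \<sigma>_def abs_mult flip: left_diff_distrib)
    ultimately show "norm (u h - u (- h)) \<le> \<bar>D (u h) - D (u (- h))\<bar> + \<bar>\<sigma> h - \<sigma> (- h)\<bar>"
      using norm_triangle_ineq[of "(D (u h) - D (u (- h))) *\<^sub>R p" "(be (u h) - be (u (- h))) *\<^sub>R k"] p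
      by simp
  qed
qed

section \<open>Chords parallel to a singular direction\<close>

locale sphere_isometry = sphere_frame x e al be cm cp
  for x e :: "'a::real_normed_vector" and al be cm cp +
  fixes \<tau> :: "'a \<Rightarrow> 'b::real_normed_vector"
  assumes slopes: "cm < cp" and dimY: "dim (UNIV :: 'b set) = 2"
    and norm_\<tau>: "norm u = 1 \<Longrightarrow> norm (\<tau> u) = 1"
    and isometry: "norm u = 1 \<Longrightarrow> norm v = 1 \<Longrightarrow> norm (\<tau> u - \<tau> v) = norm (u - v)"
begin

abbreviation gap :: "real \<Rightarrow> real" where "gap b \<equiv> height b + height (- b)"

lemma gap_pos: "\<bar>b\<bar> < 1 \<Longrightarrow> 0 < gap b"
  using height_pos[of b] height_pos[of "-b"] by simp

lemma norm_chord_image: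
  assumes "\<bar>b\<bar> < 1"
  shows "norm (\<tau> (curve b) - \<tau> (- curve (- b))) = gap b"
  using assms isometry[of "curve b" "- curve (- b)"] chord[of b] gap_pos[OF assms]
  by (simp add: norm_curve)

text \<open>By contradiction, through the second difference of the chord length: smoothness in the
  image direction makes it \<open>o(h)\<close>, while the two slopes at \<open>x\<close> keep its
  quotient by \<open>h\<close> near or above \<open>cp - cm\<close>. Differentiability of
  \<open>height\<close> at \<open>b\<close> supplies a tangent to the arc, and that of the norm at
  the image end makes the displacements cancel.\<close>

lemma chord_direction_nondiff:
  assumes b: "\<bar>b\<bar> < 1" and height: "height differentiable (at b)"
    and p_diff: "norm differentiable (at (\<tau> (curve b)))"
  shows "(1 / gap b) *\<^sub>R (\<tau> (curve b) - \<tau> (- curve (- b))) \<in> nondiff_points"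
proof -
  define r where "r = gap b"
  define p where "p = \<tau> (curve b)"
  define m where "m = \<tau> (- curve (- b))"
  define y where "y = (1 / r) *\<^sub>R (p - m)"
  have "r > 0" unfolding r_def by (rule gap_pos[OF b])
  have "norm p = 1" unfolding p_def using b by (simp add: norm_\<tau> norm_curve)
  have pm: "norm (p - m) = r" unfolding p_def m_def r_def by (rule norm_chord_image[OF b])
  have ny: "norm y = 1" using pm \<open>r > 0\<close> by (simp add: y_def)
  have ry: "p - m = r *\<^sub>R y" using \<open>r > 0\<close> by (simp add: y_def)
  have "\<not> norm differentiable (at y)"
  proof
    assume y: "norm differentiable (at y)"
    \<comment> \<open>By positive homogeneity, differentiability at the unit vector \<open>y\<close>
      passes to the full chord vector \<open>p - m\<close>.\<close>
    have "(norm \<circ> (\<lambda>z. (1 / r) *\<^sub>R z)) differentiable (at (p - m))"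
      by (rule differentiable_chain_at) (use y in \<open>auto simp: y_def\<close>)
    then have "(\<lambda>z. r * (norm \<circ> (\<lambda>z. (1 / r) *\<^sub>R z)) z) differentiable (at (p - m))"
      by (intro differentiable_mult differentiable_const)
    moreover have "(\<lambda>z. r * (norm \<circ> (\<lambda>z. (1 / r) *\<^sub>R z)) z) = (norm :: 'b \<Rightarrow> real)"
      using \<open>r > 0\<close> by auto
    ultimately obtain E where E: "(norm has_derivative E) (at (p - m))"
      by (auto simp: differentiable_def)
    have blE: "bounded_linear E" using E by (rule has_derivative_bounded_linear)
    obtain s where s: "(height has_real_derivative s) (at b)"
      using height by (auto simp: real_differentiable_def)
    define S where "S h = (height (b + h) - height b) / h" for h
    have S: "(S \<longlongrightarrow> s) (at 0)" using s unfolding S_def by (simp add: DERIV_def)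
    note S' = tendsto_at_0_uminus[OF S]
    define w where "w = s *\<^sub>R x + e"
    define u where "u h = (1 / h) *\<^sub>R (\<tau> (curve (b + h)) - p)" for h
    define dir where "dir h = S h *\<^sub>R x + e" for h
    have dir: "(dir \<longlongrightarrow> w) (at 0)" unfolding dir_def w_def by (intro tendsto_intros S)
    have curve_dir: "curve (b + h) - curve b = h *\<^sub>R dir h" if "h \<noteq> 0" for h
    proof -
      have "h * S h = height (b + h) - height b" using that by (simp add: S_def)
      then show ?thesis by (simp add: sphere_arc_def dir_def scaleR_add_right scaleR_add_left scaleR_diff_left)
    qed
    have hu: "p + h *\<^sub>R u h = \<tau> (curve (b + h))" if "h \<noteq> 0" for h
      using that by (simp add: u_def)
    have small: "\<forall>\<^sub>F h in at (0::real). h \<noteq> 0 \<and> \<bar>b + h\<bar> < 1 \<and> \<bar>b - h\<bar> < 1"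
      unfolding eventually_at using b by (intro exI[of _ "1 - \<bar>b\<bar>"]) auto
    have norm_u: "\<forall>\<^sub>F h in at 0. norm (dir h) = norm (u h)"
      using small
    proof eventually_elim
      case (elim h)
      have "norm (\<tau> (curve (b + h)) - p) = norm (curve (b + h) - curve b)"
        unfolding p_def using elim b by (intro isometry norm_curve) auto
      then show ?case using curve_dir[of h] elim by (simp add: u_def)
    qed
    \<comment> \<open>This is the distance between the two displaced ends; it shows that the image
      displacements are as far apart as if they were opposite.\<close>
    have norm_u2: "\<forall>\<^sub>F h in at 0. norm (dir h + dir (- h)) = norm (u h + u (- h))"
      using small
    proof eventually_elim
      case (elim h)
      have "norm (\<tau> (curve (b + h)) - \<tau> (curve (b - h))) = norm (curve (b + h) - curve (b - h))"
        using elim b by (intro isometry norm_curve) auto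
      moreover have "\<tau> (curve (b + h)) - \<tau> (curve (b - h)) = h *\<^sub>R (u h + u (- h))"
        using elim by (simp add: u_def algebra_simps)
      moreover have "curve (b + h) - curve (b - h) = h *\<^sub>R (dir h + dir (- h))"
        using curve_dir[of h] curve_dir[of "-h"] elim by (simp add: algebra_simps)
      ultimately show ?case using elim by simp
    qed
    have lim1: "((\<lambda>h. norm (u h)) \<longlongrightarrow> norm w) (at 0)"
      by (rule Lim_transform_eventually[OF tendsto_norm[OF dir] norm_u])
    have "norm (w + w) = 2 * norm w" by (simp flip: scaleR_2)
    then have lim2: "((\<lambda>h. norm (u h + u (- h))) \<longlongrightarrow> 2 * norm w) (at 0)"
      using Lim_transform_eventually[OF tendsto_norm[OF tendsto_add[OF dir tendsto_at_0_uminus[OF dir]]] norm_u2]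
      by simp
    have on: "\<forall>\<^sub>F h in at 0. norm (p + h *\<^sub>R u h) = 1"
      using small by eventually_elim (simp add: hu norm_\<tau> norm_curve)
    have opp: "((\<lambda>h. u h - u (- h)) \<longlongrightarrow> 0) (at 0)"
      by (rule opposite_directions[OF dimY \<open>norm p = 1\<close> _ on lim1 lim2]) (use p_diff p_def in simp)
    have bdd: "\<forall>\<^sub>F h in at 0. norm (u h) \<le> norm w + 1"
      using order_tendstoD(2)[OF lim1, of "norm w + 1"] by (auto elim: eventually_mono)
    \<comment> \<open>Length of the segment from the fixed lower end \<open>- curve (- b)\<close> to
      the moving upper end; \<open>\<psi> 0\<close> would be \<open>r\<close>.\<close>
    define \<psi> where "\<psi> h = norm (curve (b + h) + curve (- b))" for h
    define T where "T h = (norm (p - m + h *\<^sub>R u h) - norm (p - m)) / h - E (u h)" for h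
    have T: "(T \<longlongrightarrow> 0) (at 0)" unfolding T_def by (rule has_derivative_moving_direction[OF E bdd])
    \<comment> \<open>Both displacements are divided by their signed parameter, so opposite
      displacements mean that \<open>u h - u (- h)\<close> vanishes in the limit, and the linear
      terms cancel although neither need converge.\<close>
    have "((\<lambda>h. T h - T (- h) + E (u h - u (- h))) \<longlongrightarrow> 0) (at 0)"
      using tendsto_add[OF tendsto_diff[OF T tendsto_at_0_uminus[OF T]] bounded_linear.tendsto_zero[OF blE opp]]
      by simp
    moreover have "\<forall>\<^sub>F h in at 0. T h - T (- h) + E (u h - u (- h)) = (\<psi> h + \<psi> (- h) - 2 * r) / h"
      using small
    proof eventually_elim
      case (elim h)
      have \<psi>: "norm (p - m + k *\<^sub>R u k) = \<psi> k" if "k \<noteq> 0" "\<bar>b + k\<bar> < 1" for k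
      proof -
        have "p - m + k *\<^sub>R u k = \<tau> (curve (b + k)) - \<tau> (- curve (- b))"
          using hu[OF that(1)] by (simp add: m_def algebra_simps)
        then show ?thesis
          using isometry[of "curve (b + k)" "- curve (- b)"] that b by (simp add: \<psi>_def norm_curve)
      qed
      have "T h = (\<psi> h - r) / h - E (u h)" using elim \<psi>[of h] pm by (simp add: T_def)
      moreover have "T (- h) = - ((\<psi> (- h) - r) / h) - E (u (- h))"
        using elim \<psi>[of "-h"] pm by (simp add: T_def)
      moreover have "E (u h - u (- h)) = E (u h) - E (u (- h))"
        by (rule linear_diff[OF bounded_linear.linear[OF blE]])
      ultimately show ?case by (simp add: add_divide_distrib diff_divide_distrib)
    qed
    ultimately have "((\<lambda>h. (\<psi> h + \<psi> (- h) - 2 * r) / h) \<longlongrightarrow> 0) (at 0)"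
      by (rule Lim_transform_eventually)
    then have up: "((\<lambda>h. (\<psi> h + \<psi> (- h) - 2 * r) / h) \<longlongrightarrow> 0) (at_right 0)"
      by (rule tendsto_mono[OF at_le, rotated]) simp
    have "((\<lambda>h. S h - S (- h) + (cp - cm)) \<longlongrightarrow> cp - cm) (at 0)"
      using tendsto_add[OF tendsto_diff[OF S S'] tendsto_const[of "cp - cm"]] by simp
    then have low: "((\<lambda>h. S h - S (- h) + (cp - cm)) \<longlongrightarrow> cp - cm) (at_right 0)"
      by (rule tendsto_mono[OF at_le, rotated]) simp
    have "\<forall>\<^sub>F h in at_right (0::real). S h - S (- h) + (cp - cm) \<le> (\<psi> h + \<psi> (- h) - 2 * r) / h"
      using eventually_at_right_less
    proof eventually_elim
      case (elim h)
      \<comment> \<open>The functional with slope \<open>cp\<close> is used for the step to the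
        right and the one with slope \<open>cm\<close> for the step to the left; their difference is
        the corner that survives.\<close>
      have "\<psi> h \<ge> r + (height (b + h) - height b) + cp * h"
        using right_functional_le[of "curve (b + h) + curve (- b)"] by (simp add: \<psi>_def r_def)
      moreover have "\<psi> (- h) \<ge> r + (height (b - h) - height b) - cm * h"
        using left_functional_le[of "curve (b - h) + curve (- b)"] by (simp add: \<psi>_def r_def)
      ultimately have "(height (b + h) - height b) + (height (b - h) - height b) + (cp - cm) * h
          \<le> \<psi> h + \<psi> (- h) - 2 * r"
        by (simp add: algebra_simps)
      then have "((height (b + h) - height b) + (height (b - h) - height b) + (cp - cm) * h) / h
          \<le> (\<psi> h + \<psi> (- h) - 2 * r) / h"
        using elim by (intro divide_right_mono) auto
      moreover have "((height (b + h) - height b) + (height (b - h) - height b) + (cp - cm) * h) / h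
          = S h - S (- h) + (cp - cm)"
        using elim by (simp add: S_def add_divide_distrib diff_divide_distrib)
      ultimately show ?case by simp
    qed
    from tendsto_le[OF _ up low this] have "cp - cm \<le> 0" by simp
    then show False using slopes by simp
  qed
  then show ?thesis
    using ny unfolding y_def p_def m_def r_def nondiff_points_def unit_sphere_def by blast
qed

lemma inj_on_\<tau>_curve: "inj_on (\<lambda>b. \<tau> (curve b)) {-1<..<1}"
proof (rule inj_onI)
  fix b c assume "b \<in> {-1<..<1}" "c \<in> {-1<..<1}" "\<tau> (curve b) = \<tau> (curve c)"
  then have "norm (curve b - curve c) = 0"
    using isometry[of "curve b" "curve c"] by (simp add: norm_curve abs_le_iff)
  then show "b = c" using be_curve by (metis eq_iff_diff_eq_0 norm_eq_zero)
qed

lemma continuous_on_\<tau>: "continuous_on {u. norm u = 1} \<tau>"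
  unfolding continuous_on_iff dist_norm using isometry by auto

lemma continuous_on_\<tau>_curve: "continuous_on {-1<..<1} (\<lambda>b. \<tau> (curve b))"
  by (rule continuous_on_compose2[OF continuous_on_\<tau> continuous_on_curve])
     (auto simp: norm_curve abs_le_iff)

lemma continuous_on_\<tau>_opposite_curve: "continuous_on {-1<..<1} (\<lambda>b. \<tau> (- curve (- b)))"
proof -
  have "continuous_on {-1<..<1} (\<lambda>b. curve (- b))"
    by (rule continuous_on_compose2[OF continuous_on_curve]) (auto intro: continuous_intros)
  from continuous_on_compose2[OF continuous_on_\<tau> continuous_on_minus[OF this]] show ?thesis
    by (simp add: image_subset_iff norm_curve abs_le_iff)
qed

lemma constant_chord_direction:
  obtains y where "y \<in> nondiff_points"
    "\<And>b. \<bar>b\<bar> < 1 \<Longrightarrow> \<tau> (curve b) - \<tau> (- curve (- b)) = gap b *\<^sub>R y"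
proof -
  define Y where "Y b = (1 / gap b) *\<^sub>R (\<tau> (curve b) - \<tau> (- curve (- b)))" for b
  let ?I = "{-1<..<1} :: real set"
  let ?N = "nondiff_points :: 'b set"
  obtain z :: 'b where "norm z = 1" using norm_\<tau> norm_x by blast
  then obtain e' al' be' cm' cp' where "sphere_frame z e' al' be' cm' cp'"
    using sphere_frame_exists[OF dimY] by blast
  then have N: "countable ?N" by (rule sphere_frame.countable_nondiff_points)
  \<comment> \<open>The first set is countable by concavity of \<open>height\<close>, the second
    because \<open>\<tau>\<close> is injective along the arc and \<open>?N\<close> is
    countable.\<close>
  define Z where "Z = {b \<in> ?I. \<not> height differentiable (at b)} \<union> {b \<in> ?I. \<tau> (curve b) \<in> ?N}"
  have Z: "countable Z" unfolding Z_def
    using countable_nondifferentiable_height countable_image_inj_gen[OF inj_on_\<tau>_curve N] by auto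
  have in_N: "Y b \<in> ?N" if "b \<in> ?I - Z" for b
    unfolding Y_def
  proof (rule chord_direction_nondiff)
    show "\<bar>b\<bar> < 1" using that by auto
    then have "norm (\<tau> (curve b)) = 1" by (simp add: norm_\<tau> norm_curve)
    then show "norm differentiable (at (\<tau> (curve b)))"
      using that by (auto simp: Z_def nondiff_points_def unit_sphere_def)
  qed (use that in \<open>auto simp: Z_def\<close>)
  have "continuous_on ?I (\<lambda>b. height (- b))"
    by (rule continuous_on_compose2[OF continuous_on_height]) (auto intro: continuous_intros)
  moreover have "\<forall>b\<in>?I. gap b \<noteq> 0" using gap_pos by (metis abs_less_iff greaterThanLessThan_iff less_irrefl minus_less_iff)
  ultimately have "continuous_on ?I Y"
    unfolding Y_def
    by (intro continuous_intros continuous_on_height continuous_on_\<tau>_curve continuous_on_\<tau>_opposite_curve)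
  then have conn: "connected (Y ` ?I)" by (rule connected_continuous_image) simp
  \<comment> \<open>Nothing is known about \<open>Y\<close> on \<open>Z\<close>, but a countable set
    has a countable image. A countable connected set is then a single point.\<close>
  have "Y ` ?I \<subseteq> ?N \<union> Y ` Z" using in_N by blast
  then have cnt: "countable (Y ` ?I)"
    by (rule countable_subset) (use N Z in auto)
  have const: "Y b = Y c" if "b \<in> ?I" "c \<in> ?I" for b c
    using connected_uncountable[OF conn, of "Y b" "Y c"] cnt that by blast
  \<comment> \<open>Constancy alone does not make the common direction singular; one parameter
    outside \<open>Z\<close> does.\<close>
  have "\<not> ?I \<subseteq> Z" using Z countable_subset uncountable_open_interval[of "-1::real" 1] by auto
  then obtain b0 where b0: "b0 \<in> ?I - Z" by blast
  show thesis
  proof (rule that[of "Y b0"])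
    show "Y b0 \<in> ?N" by (rule in_N[OF b0])
    fix b :: real assume b: "\<bar>b\<bar> < 1"
    then have "Y b = Y b0" using const b0 by (simp add: abs_less_iff)
    moreover have "\<tau> (curve b) - \<tau> (- curve (- b)) = gap b *\<^sub>R Y b"
      using gap_pos[OF b] by (simp add: Y_def)
    ultimately show "\<tau> (curve b) - \<tau> (- curve (- b)) = gap b *\<^sub>R Y b0" by simp
  qed
qed

end

section \<open>Rigidity in adapted coordinates\<close>

locale aligned_isometry =
  sphere_isometry x e al be cm cp \<tau> + Y: sphere_frame y e' al' be' cm' cp'
  for x e :: "'a::real_normed_vector" and al be cm cp and \<tau> :: "'a \<Rightarrow> 'b::real_normed_vector"
    and y e' :: 'b and al' be' cm' cp' +
  assumes chord_image: "\<bar>b\<bar> < 1 \<Longrightarrow> \<tau> (curve b) - \<tau> (- curve (- b)) = gap b *\<^sub>R y"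
    and slopes_Y: "cm' < cp'"
begin

text \<open>Reversing \<open>e\<close> and \<open>e'\<close> together preserves the sense of
  monotonicity and exchanges right and left functionals on both sides.\<close>

lemma reflect_aligned:
  "aligned_isometry x (- e) al (\<lambda>z. - be z) (- cp) (- cm) \<tau> y (- e') al' (\<lambda>z. - be' z) (- cp') (- cm')"
proof -
  interpret r: sphere_frame x "- e" al "\<lambda>z. - be z" "- cp" "- cm" by (rule reflect)
  interpret rY: sphere_frame y "- e'" al' "\<lambda>z. - be' z" "- cp'" "- cm'" by (rule Y.reflect)
  show ?thesis
  proof
    fix b :: real assume "\<bar>b\<bar> < 1"
    then show "\<tau> (sphere_arc x (- e) b) - \<tau> (- sphere_arc x (- e) (- b)) =
        (arc_height x (- e) b + arc_height x (- e) (- b)) *\<^sub>R y"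
      using chord_image[of "- b"] by (simp add: sphere_arc_reflect arc_height_reflect)
  qed (use slopes slopes_Y dimY norm_\<tau> isometry in auto)
qed

text \<open>Reversing \<open>e'\<close> alone makes a decreasing \<open>be'\<close>-coordinate along
  the image arc increasing.\<close>

lemma reflect_codomain:
  "aligned_isometry x e al be cm cp \<tau> y (- e') al' (\<lambda>z. - be' z) (- cp') (- cm')"
proof -
  interpret rY: sphere_frame y "- e'" al' "\<lambda>z. - be' z" "- cp'" "- cm'" by (rule Y.reflect)
  show ?thesis
    by unfold_locales (use chord_image slopes_Y in auto)
qed

text \<open>Two image chords on one line would have ordered ends and additive distances. If
  \<open>m2\<close> falls inside the first chord, equality in the triangle inequality pins its
  preimage to the first chord in \<open>X\<close>. If it falls beyond, then in \<open>X\<close> a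
  downward vector would gain the full length \<open>gap b1\<close> by adding
  \<open>gap b1 *\<^sub>R x\<close>.\<close>

lemma parallel_chords_not_collinear:
  assumes b: "\<bar>b1\<bar> < 1" "\<bar>b2\<bar> < 1" "b1 \<noteq> b2" and eq: "be' (\<tau> (curve b1)) = be' (\<tau> (curve b2))"
    and le: "al' (\<tau> (- curve (- b1))) \<le> al' (\<tau> (- curve (- b2)))"
  shows False
proof -
  define g1 where "g1 = curve b1" define g2 where "g2 = curve b2"
  define m1 where "m1 = - curve (- b1)" define m2 where "m2 = - curve (- b2)"
  have n: "norm g1 = 1" "norm g2 = 1" "norm m1 = 1" "norm m2 = 1"
    using b by (auto simp: g1_def g2_def m1_def m2_def norm_curve)
  have g1m1: "g1 - m1 = gap b1 *\<^sub>R x" using chord[of b1] by (simp add: g1_def m1_def)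
  have t1: "\<tau> g1 - \<tau> m1 = gap b1 *\<^sub>R y" using chord_image[OF b(1)] by (simp add: g1_def m1_def)
  have t2: "\<tau> g2 - \<tau> m2 = gap b2 *\<^sub>R y" using chord_image[OF b(2)] by (simp add: g2_def m2_def)
  have be': "be' (\<tau> m1) = be' (\<tau> g1)" "be' (\<tau> m2) = be' (\<tau> g1)"
    using arg_cong[OF t1, of be'] arg_cong[OF t2, of be'] eq by (auto simp: g1_def g2_def)
  have al1: "al' (\<tau> g1) - al' (\<tau> m1) = gap b1" using arg_cong[OF t1, of al'] by simp
  have dist: "norm (u - v) = \<bar>al' (\<tau> u) - al' (\<tau> v)\<bar>"
    if "norm u = 1" "norm v = 1" "be' (\<tau> u) = be' (\<tau> v)" for u v
  proof -
    have "\<tau> u - \<tau> v = (al' (\<tau> u) - al' (\<tau> v)) *\<^sub>R y"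
      by (rule Y.eqI) (use that in auto)
    then show ?thesis using isometry[OF that(1,2)] by simp
  qed
  have le': "al' (\<tau> m1) \<le> al' (\<tau> m2)" using le by (simp add: m1_def m2_def)
  have r1: "gap b1 > 0" by (rule gap_pos[OF b(1)])
  show False
  proof (cases "al' (\<tau> m2) \<le> al' (\<tau> g1)")
    case True
    have sum: "norm (m2 - m1) + norm (g1 - m2) = gap b1"
      using dist[of m2 m1] dist[of g1 m2] n be' le' True al1 by simp
    \<comment> \<open>The functionals take the value \<open>gap b1\<close> on
      \<open>g1 - m1\<close>, which equals the sum of the two norms, so both must attain the norm on
      \<open>m2 - m1\<close>; as \<open>cm < cp\<close>, its \<open>be\<close> vanishes.\<close>
    have F: "al (m2 - m1) + cp * be (m2 - m1) = norm (m2 - m1)"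
      using right_functional_le[of "m2 - m1"] right_functional_le[of "g1 - m2"] sum
        arg_cong[OF g1m1, of al] arg_cong[OF g1m1, of be] by (simp add: algebra_simps)
    have G: "al (m2 - m1) + cm * be (m2 - m1) = norm (m2 - m1)"
      using left_functional_le[of "m2 - m1"] left_functional_le[of "g1 - m2"] sum
        arg_cong[OF g1m1, of al] arg_cong[OF g1m1, of be] by (simp add: algebra_simps)
    have "(cp - cm) * be (m2 - m1) = 0" using F G by (simp add: algebra_simps)
    then have "be (m2 - m1) = 0" using slopes by simp
    then show False using b by (simp add: m1_def m2_def)
  next
    case False
    define v where "v = m2 - g1"
    have "norm (m2 - m1) = norm (m2 - g1) + gap b1"
      using dist[of m2 m1] dist[of m2 g1] n be' le' False al1 by simp
    moreover have "m2 - m1 = v + gap b1 *\<^sub>R x" using g1m1 by (simp add: v_def algebra_simps)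
    ultimately have eqn: "norm (v + gap b1 *\<^sub>R x) = norm v + gap b1" by (simp add: v_def)
    have al: "al v < 0" using height_pos[of b1] height_pos[of "- b2"] b by (simp add: v_def m2_def g1_def)
    have vd: "v = al v *\<^sub>R x + be v *\<^sub>R e" by (rule decomp)
    have ble: "\<bar>be v\<bar> \<le> norm v" by (rule abs_be_le)
    show False
    proof (cases "- al v \<le> gap b1")
      case True
      have "v + gap b1 *\<^sub>R x = (gap b1 + al v) *\<^sub>R x + be v *\<^sub>R e" by (rule eqI) auto
      then have "norm (v + gap b1 *\<^sub>R x) \<le> (gap b1 + al v) + \<bar>be v\<bar>"
        using norm_triangle_ineq[of "(gap b1 + al v) *\<^sub>R x" "be v *\<^sub>R e"] True by simp
      then show False using eqn al ble by simp
    next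
      case c: False
      \<comment> \<open>Chosen so that adding \<open>gap b1 *\<^sub>R x\<close> cancels the
        \<open>al\<close>-coordinate of \<open>t *\<^sub>R v\<close>, leaving a convex combination
        of \<open>v\<close> and \<open>be v *\<^sub>R e\<close>, both of norm at most
        \<open>norm v\<close>.\<close>
      define t where "t = gap b1 / (- al v)"
      have t: "0 \<le> t" "t \<le> 1" using c r1 al by (auto simp: t_def field_simps)
      have "t * al v = - gap b1" using al by (simp add: t_def)
      then have "v + gap b1 *\<^sub>R x = (1 - t) *\<^sub>R v + (t * be v) *\<^sub>R e"
        by (intro eqI) (auto simp: algebra_simps)
      then have "norm (v + gap b1 *\<^sub>R x) \<le> (1 - t) * norm v + t * \<bar>be v\<bar>"
        using norm_triangle_ineq[of "(1 - t) *\<^sub>R v" "(t * be v) *\<^sub>R e"] t by (simp add: abs_mult)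
      also have "\<dots> \<le> (1 - t) * norm v + t * norm v" using ble t by (simp add: mult_left_mono)
      also have "\<dots> = norm v" by (simp add: algebra_simps)
      finally show False using eqn r1 by simp
    qed
  qed
qed

lemma inj_on_be_\<tau>_curve: "inj_on (\<lambda>b. be' (\<tau> (curve b))) {-1<..<1}"
proof (rule inj_onI)
  fix b c :: real
  assume bc: "b \<in> {-1<..<1}" "c \<in> {-1<..<1}" "be' (\<tau> (curve b)) = be' (\<tau> (curve c))"
  then show "b = c"
    using parallel_chords_not_collinear[of b c] parallel_chords_not_collinear[of c b]
    by (cases "al' (\<tau> (- curve (- b))) \<le> al' (\<tau> (- curve (- c)))") (auto simp: abs_less_iff)
qed

text \<open>The defect \<open>f\<close> has zero right derivative: from the fixed lower end at
  \<open>t\<close>, the chords \<open>z\<close> and \<open>z'\<close> have equal norm, and each norm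
  agrees with its right functional to first order. Monotonicity places \<open>z'\<close> on the side
  where the right slope applies.\<close>

lemma right_functional_translation:
  assumes mono: "\<And>b c. -1 < b \<Longrightarrow> b < c \<Longrightarrow> c < 1 \<Longrightarrow> be' (\<tau> (curve b)) \<le> be' (\<tau> (curve c))"
  obtains k where "\<And>b. \<bar>b\<bar> < 1 \<Longrightarrow>
    al' (\<tau> (curve b)) + cp' * be' (\<tau> (curve b)) = height b + cp * b + k"
proof -
  define f where "f b = al' (\<tau> (curve b)) + cp' * be' (\<tau> (curve b)) - (height b + cp * b)" for b
  have "continuous_on {-1<..<1} (\<lambda>b. al' (\<tau> (curve b)))"
    by (rule bounded_linear.continuous_on[OF Y.bounded_linear_al continuous_on_\<tau>_curve])
  moreover have "continuous_on {-1<..<1} (\<lambda>b. be' (\<tau> (curve b)))"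
    by (rule bounded_linear.continuous_on[OF Y.bounded_linear_be continuous_on_\<tau>_curve])
  ultimately have cont: "continuous_on {-1<..<1} f"
    unfolding f_def by (intro continuous_intros continuous_on_height)
  have der: "\<exists>\<delta>>0. \<forall>s. t < s \<and> s < t + \<delta> \<longrightarrow> \<bar>f s - f t\<bar> \<le> \<epsilon> * (s - t)"
    if t: "t \<in> {-1<..<1}" and "\<epsilon> > 0" for t \<epsilon>
  proof -
    obtain L \<eta> where L: "\<eta> > 0" "L > 0" "\<And>s. t < s \<Longrightarrow> s < t + \<eta> \<Longrightarrow> norm (curve s - curve t) \<le> L * (s - t)"
      using curve_right_lipschitz[OF t] by blast
    define r where "r = gap t"
    have tt: "\<bar>t\<bar> < 1" using t by auto
    have "r > 0" unfolding r_def by (rule gap_pos[OF tt])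
    \<comment> \<open>The step of \<open>be'\<close> is only bounded by \<open>L * (s - t)\<close>,
      so the error must stay below \<open>\<epsilon>\<close> after multiplication by
      \<open>L\<close> as well as by one.\<close>
    define \<epsilon>1 where "\<epsilon>1 = \<epsilon> / (L + 1)"
    have \<epsilon>1: "\<epsilon>1 > 0" "\<epsilon>1 \<le> \<epsilon>" "\<epsilon>1 * L \<le> \<epsilon>" using \<open>\<epsilon> > 0\<close> L by (auto simp: \<epsilon>1_def field_simps)
    obtain \<delta>1 where \<delta>1: "\<delta>1 > 0"
      "\<And>z. 0 \<le> be z \<and> be z \<le> \<delta>1 * al z \<Longrightarrow> norm z \<le> al z + cp * be z + \<epsilon>1 * be z"
      using norm_le_right[OF \<epsilon>1(1)] by auto
    obtain \<delta>2 where \<delta>2: "\<delta>2 > 0"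
      "\<And>z. 0 \<le> be' z \<and> be' z \<le> \<delta>2 * al' z \<Longrightarrow> norm z \<le> al' z + cp' * be' z + \<epsilon>1 * be' z"
      using Y.norm_le_right[OF \<epsilon>1(1)] by auto
    \<comment> \<open>The bound \<open>r / (4 * L)\<close> keeps \<open>al z\<close> and
      \<open>al' z'\<close> above \<open>r / 2\<close>; the terms with \<open>\<delta>1\<close> and
      \<open>\<delta>2\<close> then put \<open>z\<close> and \<open>z'\<close> into their cones. The
      others keep \<open>s\<close> in range.\<close>
    have "0 < Min {\<eta>, r / (4 * L), \<delta>1 * r / 2, \<delta>2 * r / (2 * L), 1 - t}"
      using L \<open>r > 0\<close> \<delta>1(1) \<delta>2(1) t by auto
    then obtain \<delta> where \<delta>: "0 < \<delta>" "\<delta> < Min {\<eta>, r / (4 * L), \<delta>1 * r / 2, \<delta>2 * r / (2 * L), 1 - t}"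
      using dense by blast
    show ?thesis
    proof (intro exI[of _ \<delta>] conjI allI impI)
      fix s assume s: "t < s \<and> s < t + \<delta>"
      have s1: "s - t < \<eta>" "s - t < \<delta>1 * r / 2" "s < 1" "t < s" using s \<delta> by auto
      have s2: "L * (s - t) \<le> r / 4" "L * (s - t) \<le> \<delta>2 * (r / 2)"
      proof -
        have "s - t < r / (4 * L)" "s - t < \<delta>2 * r / (2 * L)" using s \<delta> by auto
        then show "L * (s - t) \<le> r / 4" "L * (s - t) \<le> \<delta>2 * (r / 2)" using L by (auto simp: field_simps)
      qed
      have ss: "\<bar>s\<bar> < 1" using s1 t by auto
      define z where "z = curve s + curve (- t)"
      define z' where "z' = \<tau> (curve s) - \<tau> (- curve (- t))"
      have lip: "norm (curve s - curve t) \<le> L * (s - t)" using L(3)[of s] s1 by simp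
      have lip': "norm (\<tau> (curve s) - \<tau> (curve t)) \<le> L * (s - t)"
        using lip isometry[of "curve s" "curve t"] ss tt by (simp add: norm_curve)
      have nz: "norm z' = norm z"
        using isometry[of "curve s" "- curve (- t)"] ss tt by (simp add: z_def z'_def norm_curve)
      have z: "al z = r + (height s - height t)" "be z = s - t" by (auto simp: z_def r_def)
      have "z' = r *\<^sub>R y + (\<tau> (curve s) - \<tau> (curve t))"
        using chord_image[OF tt] by (simp add: z'_def r_def algebra_simps)
      then have z': "al' z' = r + (al' (\<tau> (curve s)) - al' (\<tau> (curve t)))"
          "be' z' = be' (\<tau> (curve s)) - be' (\<tau> (curve t))" by simp_all
      have fst: "f s - f t = (al' z' + cp' * be' z') - (al z + cp * be z)"
        by (simp add: f_def z z' algebra_simps)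
      have "al z \<ge> r / 2" using abs_al_le[of "curve s - curve t"] lip s2(1) z by simp
      then have "\<delta>1 * (r / 2) \<le> \<delta>1 * al z" using \<delta>1(1) by simp
      then have "norm z \<le> al z + cp * be z + \<epsilon>1 * be z"
        using s1 z by (intro \<delta>1(2)) auto
      moreover have "\<epsilon>1 * be z \<le> \<epsilon> * (s - t)" using z \<epsilon>1(2) s1 by simp
      moreover have "norm z' \<le> al' z' + cp' * be' z' + \<epsilon>1 * be' z'"
      proof (rule \<delta>2(2))
        have "al' z' \<ge> r / 2"
          using Y.abs_al_le[of "\<tau> (curve s) - \<tau> (curve t)"] lip' s2(1) z' by simp
        then have "\<delta>2 * (r / 2) \<le> \<delta>2 * al' z'" using \<delta>2(1) by simp
        moreover have "be' z' \<le> L * (s - t)"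
          using Y.abs_be_le[of "\<tau> (curve s) - \<tau> (curve t)"] lip' z' by simp
        ultimately show "0 \<le> be' z' \<and> be' z' \<le> \<delta>2 * al' z'"
          using s2(2) mono[of t s] z' s1 t by simp
      qed
      moreover have "\<epsilon>1 * be' z' \<le> \<epsilon> * (s - t)"
      proof -
        have "be' z' \<le> L * (s - t)"
          using Y.abs_be_le[of "\<tau> (curve s) - \<tau> (curve t)"] lip' z' by simp
        then have "\<epsilon>1 * be' z' \<le> \<epsilon>1 * (L * (s - t))" using \<epsilon>1(1) by simp
        also have "\<dots> = (\<epsilon>1 * L) * (s - t)" by simp
        also have "\<dots> \<le> \<epsilon> * (s - t)" using \<epsilon>1(3) s1 by (intro mult_right_mono) auto
        finally show ?thesis .
      qed
      ultimately show "\<bar>f s - f t\<bar> \<le> \<epsilon> * (s - t)"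
        using right_functional_le[of z] Y.right_functional_le[of z'] nz unfolding fst abs_le_iff
        by linarith
    qed (use \<delta> in auto)
  qed
  show thesis
  proof (rule that[of "f 0"])
    fix b :: real assume "\<bar>b\<bar> < 1"
    then have "f b = f 0"
      by (intro zero_right_derivative_imp_constant[OF cont der]) auto
    then show "al' (\<tau> (curve b)) + cp' * be' (\<tau> (curve b)) = height b + cp * b + f 0"
      by (simp add: f_def)
  qed
qed

lemma left_functional_translation:
  assumes mono: "\<And>b c. -1 < b \<Longrightarrow> b < c \<Longrightarrow> c < 1 \<Longrightarrow> be' (\<tau> (curve b)) \<le> be' (\<tau> (curve c))"
  obtains k where "\<And>b. \<bar>b\<bar> < 1 \<Longrightarrow>
    al' (\<tau> (curve b)) + cm' * be' (\<tau> (curve b)) = height b + cm * b + k"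
proof -
  interpret r: aligned_isometry x "- e" al "\<lambda>z. - be z" "- cp" "- cm" \<tau>
      y "- e'" al' "\<lambda>z. - be' z" "- cp'" "- cm'"
    by (rule reflect_aligned)
  obtain k where k: "\<And>b. \<bar>b\<bar> < 1 \<Longrightarrow> al' (\<tau> (curve (- b))) + cm' * be' (\<tau> (curve (- b))) = height (- b) - cm * b + k"
    using r.right_functional_translation mono by (auto simp: sphere_arc_reflect arc_height_reflect)
  show thesis using k[of "- b" for b] by (intro that[of k]) simp
qed

text \<open>A unit vector \<open>u\<close> is approximated by \<open>\<lambda> u\<close> with \<open>\<lambda> < 1\<close>, which lies on a chord parallel to
  \<open>x\<close>; the distances from \<open>u\<close> to the ends of that chord determine the functional at \<open>\<tau> u\<close> up to
  \<open>O(1 - \<lambda>)\<close>.\<close>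

lemma functional_translation_extends:
  assumes bound: "\<And>z. al' z + c' * be' z \<le> norm z"
    and k: "\<And>b. \<bar>b\<bar> < 1 \<Longrightarrow> al' (\<tau> (curve b)) + c' * be' (\<tau> (curve b)) = height b + c * b + k"
    and u: "norm u = 1"
  shows "al' (\<tau> u) + c' * be' (\<tau> u) = al u + c * be u + k"
proof -
  define \<Phi> where "\<Phi> = al u + c * be u"
  define \<Phi>' where "\<Phi>' z = al' z + c' * be' z" for z
  have \<Phi>': "\<Phi>' (z - w) = \<Phi>' z - \<Phi>' w" for z w by (simp add: \<Phi>'_def algebra_simps)
  have est: "\<bar>\<Phi>' (\<tau> u) - (l * \<Phi> + k)\<bar> \<le> 1 - l" if l: "0 < l" "l < 1" for l
  proof -
    \<comment> \<open>Shrinking keeps \<open>b\<close> strictly between \<open>-1\<close> and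
      \<open>1\<close> even if \<open>\<bar>be u\<bar> = 1\<close>. The point
      \<open>l *\<^sub>R u\<close> lies on the chord at \<open>b\<close>, at distances
      \<open>s\<close> and \<open>s'\<close> below from its lower and upper ends.\<close>
    define b where "b = l * be u"
    have "\<bar>b\<bar> \<le> l" using abs_be_le[of u] u l by (simp add: b_def abs_mult mult_left_le)
    then have b: "\<bar>b\<bar> < 1" using l by simp
    define g where "g = curve b" define m where "m = - curve (- b)"
    have gm: "norm g = 1" "norm m = 1" using b by (auto simp: g_def m_def norm_curve)
    define s where "s = l * al u + height (- b)"
    define s' where "s' = height b - l * al u"
    have "s' \<ge> 0" using al_le_height[of "l *\<^sub>R u"] l u by (simp add: s'_def b_def)
    have "s \<ge> 0" using al_le_height[of "- (l *\<^sub>R u)"] l u by (simp add: s_def b_def)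
    have "u - m = (1 - l) *\<^sub>R u + s *\<^sub>R x"
      by (rule eqI) (auto simp: m_def s_def b_def algebra_simps)
    then have um: "norm (u - m) \<le> (1 - l) + s"
      using norm_triangle_ineq[of "(1 - l) *\<^sub>R u" "s *\<^sub>R x"] l u \<open>s \<ge> 0\<close> by simp
    have "g - u = s' *\<^sub>R x - (1 - l) *\<^sub>R u"
      by (rule eqI) (auto simp: g_def s'_def b_def algebra_simps)
    then have gu: "norm (g - u) \<le> (1 - l) + s'"
      using norm_triangle_ineq4[of "s' *\<^sub>R x" "(1 - l) *\<^sub>R u"] l u \<open>s' \<ge> 0\<close> by simp
    have g: "\<Phi>' (\<tau> g) = height b + c * b + k" using k[OF b] by (simp add: g_def \<Phi>'_def)
    \<comment> \<open>As \<open>\<Phi>' y = 1\<close>, the image chord has value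
      \<open>gap b = s + s'\<close>; the estimates from its two ends then trap
      \<open>\<Phi>' (\<tau> u)\<close> in an interval of width \<open>2 * (1 - l)\<close>.\<close>
    have "\<tau> g - \<tau> m = gap b *\<^sub>R y" using chord_image[OF b] by (simp add: g_def m_def)
    then have "\<Phi>' (\<tau> g) - \<Phi>' (\<tau> m) = gap b" by (simp flip: \<Phi>') (simp add: \<Phi>'_def)
    moreover have "\<Phi>' (\<tau> u) - \<Phi>' (\<tau> m) \<le> (1 - l) + s"
      using bound[of "\<tau> u - \<tau> m"] isometry[OF u gm(2)] um by (simp flip: \<Phi>') (simp add: \<Phi>'_def)
    moreover have "\<Phi>' (\<tau> g) - \<Phi>' (\<tau> u) \<le> (1 - l) + s'"
      using bound[of "\<tau> g - \<tau> u"] isometry[OF gm(1) u] gu by (simp flip: \<Phi>') (simp add: \<Phi>'_def)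
    moreover have "l * \<Phi> = l * al u + c * b" by (simp add: \<Phi>_def b_def algebra_simps)
    ultimately show ?thesis using g by (simp add: s_def s'_def abs_le_iff)
  qed
  have "((\<lambda>l. \<bar>\<Phi>' (\<tau> u) - (l * \<Phi> + k)\<bar>) \<longlongrightarrow> \<bar>\<Phi>' (\<tau> u) - (1 * \<Phi> + k)\<bar>) (at_left (1::real))"
    by (intro tendsto_intros)
  moreover have "((\<lambda>l. 1 - l) \<longlongrightarrow> 1 - 1) (at_left (1::real))" by (intro tendsto_intros)
  moreover have "\<forall>\<^sub>F l in at_left (1::real). \<bar>\<Phi>' (\<tau> u) - (l * \<Phi> + k)\<bar> \<le> 1 - l"
    using eventually_at_left_real[of 0 "1::real"] by (rule eventually_mono) (use est in auto)
  ultimately have "\<bar>\<Phi>' (\<tau> u) - (1 * \<Phi> + k)\<bar> \<le> 1 - 1"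
    by (intro tendsto_le[OF trivial_limit_at_left_real])
  then show ?thesis by (simp add: \<Phi>_def \<Phi>'_def)
qed

text \<open>The two functionals are coordinates on \<open>Y\<close>, so knowing both along
  \<open>\<tau>\<close> up to constants determines \<open>\<tau>\<close> up to one translation;
  \<open>T\<close> is the linear map that pulls them back to their counterparts on
  \<open>X\<close>.\<close>

lemma linear_extension_if_mono:
  assumes mono: "\<And>b c. -1 < b \<Longrightarrow> b < c \<Longrightarrow> c < 1 \<Longrightarrow> be' (\<tau> (curve b)) \<le> be' (\<tau> (curve c))"
  shows "\<exists>T. linear T \<and> (\<forall>u. norm u = 1 \<longrightarrow> T u = \<tau> u) \<and> (\<forall>z. norm (T z) = norm z)"
proof -
  obtain k1 where k1: "\<And>b. \<bar>b\<bar> < 1 \<Longrightarrow>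
      al' (\<tau> (curve b)) + cp' * be' (\<tau> (curve b)) = height b + cp * b + k1"
    using right_functional_translation[OF mono] by blast
  obtain k2 where k2: "\<And>b. \<bar>b\<bar> < 1 \<Longrightarrow>
      al' (\<tau> (curve b)) + cm' * be' (\<tau> (curve b)) = height b + cm * b + k2"
    using left_functional_translation[OF mono] by blast
  note F = functional_translation_extends[OF Y.right_functional_le k1]
  note G = functional_translation_extends[OF Y.left_functional_le k2]
  \<comment> \<open>Forced by subtracting the two pull-back equations:
    \<open>(cp' - cm') * be' (T z) = (cp - cm) * be z\<close>.\<close>
  define \<kappa> where "\<kappa> = (cp - cm) / (cp' - cm')"
  have \<kappa>: "\<kappa> > 0" "\<kappa> * (cp' - cm') = cp - cm" using slopes slopes_Y by (auto simp: \<kappa>_def)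
  define T where "T z = (al z + (cp - cp' * \<kappa>) * be z) *\<^sub>R y + (\<kappa> * be z) *\<^sub>R e'" for z
  have lin: "linear T" unfolding T_def by (intro linearI) (auto simp: algebra_simps)
  have FT: "al' (T z) + cp' * be' (T z) = al z + cp * be z" for z
    by (simp add: T_def algebra_simps)
  have GT: "al' (T z) + cm' * be' (T z) = al z + cm * be z" for z
  proof -
    have "al' (T z) + cm' * be' (T z) = al z + (cp - \<kappa> * (cp' - cm')) * be z"
      by (simp add: T_def algebra_simps)
    then show ?thesis by (simp only: \<kappa>(2)) simp
  qed
  define c where "c = \<tau> x - T x"
  have \<tau>T: "\<tau> u = T u + c" if u: "norm u = 1" for u
  proof -
    define d where "d = \<tau> u - T u - c"
    have f: "al' d + cp' * be' d = 0"
      using F[OF _ u] F[OF _ norm_x] FT[of u] FT[of x] by (simp add: d_def c_def algebra_simps)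
    have g: "al' d + cm' * be' d = 0"
      using G[OF _ u] G[OF _ norm_x] GT[of u] GT[of x] by (simp add: d_def c_def algebra_simps)
    have "(cp' - cm') * be' d = 0" using f g unfolding left_diff_distrib by linarith
    then have "be' d = 0" using slopes_Y by simp
    then have "d = 0" using f by (intro Y.eqI) auto
    then show ?thesis by (simp add: d_def algebra_simps)
  qed
  have nT1: "norm (T u) = 1" if u: "norm u = 1" for u
  proof -
    have "\<tau> u - \<tau> (- u) = 2 *\<^sub>R T u" using \<tau>T[of u] \<tau>T[of "- u"] u lin
      by (simp add: linear_neg scaleR_2)
    moreover have "norm (\<tau> u - \<tau> (- u)) = 2" using isometry[of u "- u"] u
      by (simp flip: scaleR_2)
    ultimately show ?thesis by simp
  qed
  have nT: "norm (T z) = norm z" for z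
  proof (cases "z = 0")
    case False
    have "norm (T (z /\<^sub>R norm z)) = 1" using False by (intro nT1) simp
    then show ?thesis using False lin by (simp add: linear_scale field_simps)
  qed (use lin linear_0 in auto)
  have "c = 0"
  proof (rule ccontr)
    assume "c \<noteq> 0"
    define t where "t = be' c / \<kappa>"
    \<comment> \<open>The preimage of \<open>c\<close> under \<open>T\<close>, read off from the
      triangular form of \<open>T\<close> in the two frames; at its normalisation the image would
      have norm \<open>1 + norm c\<close>.\<close>
    define z where "z = (al' c - (cp - cp' * \<kappa>) * t) *\<^sub>R x + t *\<^sub>R e"
    have Tz: "T z = c" by (rule Y.eqI) (use \<kappa>(1) in \<open>auto simp: T_def z_def t_def\<close>)
    then have "norm z = norm c" using nT[of z] by simp
    then have u: "norm (z /\<^sub>R norm c) = 1" using \<open>c \<noteq> 0\<close> by simp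
    have "\<tau> (z /\<^sub>R norm c) = (inverse (norm c) + 1) *\<^sub>R c"
      using \<tau>T[OF u] lin Tz by (simp add: linear_scale algebra_simps)
    then have "1 = (inverse (norm c) + 1) * norm c" using norm_\<tau>[OF u] by (simp add: abs_of_nonneg)
    then show False using \<open>c \<noteq> 0\<close> by (simp add: algebra_simps)
  qed
  then show ?thesis using lin nT \<tau>T by auto
qed

lemma linear_extension:
  "\<exists>T. linear T \<and> (\<forall>u. norm u = 1 \<longrightarrow> T u = \<tau> u) \<and> (\<forall>z. norm (T z) = norm z)"
proof -
  let ?B = "\<lambda>b. be' (\<tau> (curve b))"
  have "continuous_on {-1<..<1} ?B"
    by (rule bounded_linear.continuous_on[OF Y.bounded_linear_be continuous_on_\<tau>_curve])
  then have "strict_mono_on {-1<..<1} ?B \<or> strict_antimono_on {-1<..<1} ?B"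
    using injective_eq_monotone_map[of "{-1<..<1::real}" ?B] inj_on_be_\<tau>_curve by (simp add: is_interval_oo)
  then show ?thesis
  proof
    assume "strict_mono_on {-1<..<1} ?B"
    then have "?B b \<le> ?B c" if "-1 < b" "b < c" "c < 1" for b c
      using that by (auto simp: monotone_on_def intro: less_imp_le)
    then show ?thesis by (rule linear_extension_if_mono)
  next
    assume anti: "strict_antimono_on {-1<..<1} ?B"
    interpret r: aligned_isometry x e al be cm cp \<tau> y "- e'" al' "\<lambda>z. - be' z" "- cp'" "- cm'"
      by (rule reflect_codomain)
    have "- ?B b \<le> - ?B c" if "-1 < b" "b < c" "c < 1" for b c
      using that anti by (auto simp: monotone_on_def intro: less_imp_le)
    then show ?thesis by (rule r.linear_extension_if_mono)
  qed
qed

end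

theorem theorem3:
  fixes x xb :: "'a::real_normed_vector"
  assumes dimX: "dim (UNIV :: 'a set) = 2"
    and pwX: "piecewise_C1_sphere TYPE('a)"
    and x_nd: "x \<in> nondiff_points" and xb_nd: "xb \<in> nondiff_points"
    and indep: "x \<noteq> xb" "independent {x, xb}"
  shows "\<forall>(\<tau> :: 'a \<Rightarrow> 'b::real_normed_vector).
           dim (UNIV :: 'b set) = 2 \<longrightarrow>
           \<tau> ` unit_sphere = unit_sphere \<longrightarrow>
           (\<forall>u\<in>unit_sphere. \<forall>v\<in>unit_sphere. norm (\<tau> u - \<tau> v) = norm (u - v)) \<longrightarrow>
           (\<exists>T. linear T \<and> (\<forall>u\<in>unit_sphere. T u = \<tau> u) \<and> (\<forall>z. norm (T z) = norm z))"
proof (intro allI impI)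
  fix \<tau> :: "'a \<Rightarrow> 'b"
  assume dimY: "dim (UNIV :: 'b set) = 2" and onto: "\<tau> ` unit_sphere = unit_sphere"
    and iso: "\<forall>u\<in>unit_sphere. \<forall>v\<in>unit_sphere. norm (\<tau> u - \<tau> v) = norm (u - v)"
  have "norm x = 1" using x_nd by (simp add: nondiff_points_def unit_sphere_def)
  then obtain e al be cm cp where "sphere_frame x e al be cm cp"
    using sphere_frame_exists[OF dimX] by blast
  then interpret X: sphere_frame x e al be cm cp .
  interpret X: sphere_isometry x e al be cm cp \<tau>
  proof
    show "cm < cp" by (rule X.slopes_less[OF x_nd])
    show "norm (\<tau> u) = 1" if "norm u = 1" for u
      using onto that by (auto simp: unit_sphere_def)
  qed (use dimY iso in \<open>auto simp: unit_sphere_def\<close>)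
  obtain y where y: "y \<in> nondiff_points"
    "\<And>b. \<bar>b\<bar> < 1 \<Longrightarrow> \<tau> (X.curve b) - \<tau> (- X.curve (- b)) = X.gap b *\<^sub>R y"
    using X.constant_chord_direction by blast
  have "norm y = 1" using y(1) by (simp add: nondiff_points_def unit_sphere_def)
  then obtain e' al' be' cm' cp' where "sphere_frame y e' al' be' cm' cp'"
    using sphere_frame_exists[OF dimY] by blast
  then interpret Y: sphere_frame y e' al' be' cm' cp' .
  interpret aligned_isometry x e al be cm cp \<tau> y e' al' be' cm' cp'
    by unfold_locales (use y(2) Y.slopes_less[OF y(1)] in auto)
  show "\<exists>T. linear T \<and> (\<forall>u\<in>unit_sphere. T u = \<tau> u) \<and> (\<forall>z. norm (T z) = norm z)"
    using linear_extension by (simp add: unit_sphere_def)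
qed

end
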